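(* Let $\phi(t)=t^{3/4}$. For any indexing category $\mathbf G$ the image of the natural inclusion $$ \mathrm{Prob}[\mathbf G]_{\mathsf h}=\mathrm{QL}_\phi(\mathrm{Prob}\langle\mathbf G\rangle_{\mathsf h},\kappa)\hookrightarrow\mathrm{Prob}[\mathbf G]=\mathrm{QL}_\phi(\mathrm{Prob}\langle\mathbf G\rangle,\kappa) $$ is dense with respect to the asymptotic distance $\hat\kappa$.
   Context: $\mathbb{N}=\{1,2,\dots\}$, $\mathbb{N}_0=\mathbb{N}\cup\{0\}$. Diagrams. A finite probability space is a set with a probability measure of finite support; its atoms are the points of positive weight, and $\mathrm{Ent}(X)=-\sum_{x}p(x)\ln p(x)$. A reduction is an equivalence class of measure-preserving maps, where maps agreeing on a set of full measure are identified. An indexing category $\mathbf G$ is a finite category with at most one morphism between any two objects in either direction (equivalently a finite poset) such that every pair of objects $i,j$ has a least common ancestor: an object $k$ with morphisms $k\to i$, $k\to j$ such that any object $l$ with morphisms $l\to i$, $l\to j$ has a morphism $l\to k$. $\mathrm{Prob}\langle\mathbf G\rangle$ is the space of $\mathbf G$-diagrams, i.e. commutative diagrams (functors) of shape $\mathbf G$ of finite probability spaces and reductions; a morphism of $\mathbf G$-diagrams is a collection of reductions between corresponding spaces commuting with the reductions within the diagrams. The tensor product $\mathcal X\otimes\mathcal Y$ takes products of corresponding probability spaces and Cartesian products of maps; its neutral element is the constant diagram of one-point spaces (isomorphic diagrams are regarded as the same), and $\mathcal X^n$ is the $n$-fold tensor power. $\mathrm{Ent}_*(\mathcal X)\in\mathbb{R}^{\mathbf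 G}$ is the vector of entropies of the individual spaces; $\mathbb{R}^{\mathbf G}$ (real functions on objects of $\mathbf G$) carries the $\ell^1$-norm $\|\cdot\|_1$. A $\mathbf G$-diagram $\mathcal X$ is homogeneous if its automorphism group $\mathrm{Aut}(\mathcal X)$ acts transitively on (the atoms of) every space in $\mathcal X$. $\mathrm{Prob}\langle\mathbf G\rangle_{\mathsf h}$ is the set of homogeneous $\mathbf G$-diagrams; it is closed under $\otimes$. Distances. For a two-fan $\mathcal F=(\mathcal X\leftarrow\mathcal Z\to\mathcal Y)$ of $\mathbf G$-diagrams (two morphisms of diagrams with common source), $\mathrm{kd}(\mathcal F)=\|\mathrm{Ent}_*\mathcal Z-\mathrm{Ent}_*\mathcal X\|_1+\|\mathrm{Ent}_*\mathcal Z-\mathrm{Ent}_*\mathcal Y\|_1$. The intrinsic entropy distance is $\mathbf{k}(\mathcal X,\mathcal Y)=\inf\{\mathrm{kd}(\mathcal F)\}$ over all two-fans $\mathcal F=(\mathcal X\leftarrow\mathcal Z\to\mathcal Y)$ with $\mathcal Z\in\mathrm{Prob}\langle\mathbf G\rangle$, and $\kappa(\mathcal X,\mathcal Y)=\lim_{n\to\infty}\frac1n\mathbf{k}(\mathcal X^{n},\mathcal Y^{n})$. Both are pseudo-distances for which $\otimes$ is $1$-Lipschitz in each argument. Quasi-linear sequences. For $\Gamma=\mathrm{Prob}\langle\mathbf G\rangle$ or $\Gamma=\mathrm{Prob}\langle\mathbf G\rangle_{\mathsf h}$, $\mathrm{QL}_\phi(\Gamma,\kappa)$ is the set of sequences $\bar{\mathcal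 X}=\{\mathcal X(i)\}_{i\in\mathbb{N}_0}$ in $\Gamma$ with $\mathcal X(0)$ the neutral element, for which there is a constant $C\ge0$ (depending on the sequence) with $\kappa(\mathcal X(m+n),\mathcal X(m)\otimes\mathcal X(n))\le C\phi(m+n)$ for all $m,n\in\mathbb{N}$. The asymptotic distance is the pseudo-distance $\hat\kappa(\bar{\mathcal X},\bar{\mathcal Y})=\lim_{n\to\infty}\frac1n\kappa(\mathcal X(n),\mathcal Y(n))$ (the limit exists and is finite). *)

theory Defs
  imports "HOL-Probability.Probability" "HOL-Library.Nat_Bijection"
begin

text \<open>
  An indexing category is given by its set of objects \<open>G\<close> and the relation \<open>r\<close>, where
  \<open>(i, j) \<in> r\<close> means that there is a (necessarily unique) morphism from \<open>i\<close> to \<open>j\<close>.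
\<close>

definition indexing_category :: "'o set \<Rightarrow> ('o \<times> 'o) set \<Rightarrow> bool" where
  "indexing_category G r \<longleftrightarrow>
     finite G \<and> partial_order_on G r \<and>
     (\<forall>i\<in>G. \<forall>j\<in>G. \<exists>k\<in>G. (k, i) \<in> r \<and> (k, j) \<in> r \<and>
        (\<forall>l\<in>G. (l, i) \<in> r \<and> (l, j) \<in> r \<longrightarrow> (l, k) \<in> r))"

text \<open>
  Every finite probability space is isomorphic, through reductions, to a probability mass
  function on \<open>nat\<close> with finite support; its atoms are the elements of \<^const>\<open>set_pmf\<close>.
  Isomorphic diagrams being regarded as the same, all spaces are taken over \<open>nat\<close>.
  A reduction is represented by a map on the points; only its values on atoms matter, so all
  equations between reductions are required on atoms only.  The values of a diagram outside the
  objects and arrows of the indexing category are irrelevant.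
\<close>

record 'o diagram =
  pspace :: "'o \<Rightarrow> nat pmf"
  red :: "'o \<Rightarrow> 'o \<Rightarrow> nat \<Rightarrow> nat"

definition reduction :: "nat pmf \<Rightarrow> nat pmf \<Rightarrow> (nat \<Rightarrow> nat) \<Rightarrow> bool" where
  "reduction p q f \<longleftrightarrow> map_pmf f p = q"

definition Prob :: "'o set \<Rightarrow> ('o \<times> 'o) set \<Rightarrow> 'o diagram set" where
  "Prob G r = {X.
     (\<forall>i\<in>G. finite (set_pmf (pspace X i))) \<and>
     (\<forall>(i, j)\<in>r. reduction (pspace X i) (pspace X j) (red X i j)) \<and>
     (\<forall>i\<in>G. \<forall>x\<in>set_pmf (pspace X i). red X i i x = x) \<and>
     (\<forall>i j k. (i, j) \<in> r \<longrightarrow> (j, k) \<in> r \<longrightarrow>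
        (\<forall>x\<in>set_pmf (pspace X i). red X j k (red X i j x) = red X i k x))}"

definition diagram_morphism ::
  "'o set \<Rightarrow> ('o \<times> 'o) set \<Rightarrow> 'o diagram \<Rightarrow> 'o diagram \<Rightarrow> ('o \<Rightarrow> nat \<Rightarrow> nat) \<Rightarrow> bool" where
  "diagram_morphism G r X Y f \<longleftrightarrow>
     (\<forall>i\<in>G. reduction (pspace X i) (pspace Y i) (f i)) \<and>
     (\<forall>(i, j)\<in>r. \<forall>x\<in>set_pmf (pspace X i). f j (red X i j x) = red Y i j (f i x))"

definition diagram_isomorphism ::
  "'o set \<Rightarrow> ('o \<times> 'o) set \<Rightarrow> 'o diagram \<Rightarrow> 'o diagram \<Rightarrow> ('o \<Rightarrow> nat \<Rightarrow> nat) \<Rightarrow> bool" where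
  "diagram_isomorphism G r X Y f \<longleftrightarrow>
     diagram_morphism G r X Y f \<and>
     (\<exists>g. diagram_morphism G r Y X g \<and>
        (\<forall>i\<in>G. (\<forall>x\<in>set_pmf (pspace X i). g i (f i x) = x) \<and>
                (\<forall>y\<in>set_pmf (pspace Y i). f i (g i y) = y)))"

definition isomorphic_diagrams ::
  "'o set \<Rightarrow> ('o \<times> 'o) set \<Rightarrow> 'o diagram \<Rightarrow> 'o diagram \<Rightarrow> bool" where
  "isomorphic_diagrams G r X Y \<longleftrightarrow> (\<exists>f. diagram_isomorphism G r X Y f)"

definition neutral :: "'o diagram" where
  "neutral = \<lparr>pspace = (\<lambda>i. return_pmf 0), red = (\<lambda>i j x. x)\<rparr>"

text \<open>The bijection \<^const>\<open>prod_encode\<close> moves the product spaces back to \<open>nat\<close>.\<close>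

definition tensor :: "'o diagram \<Rightarrow> 'o diagram \<Rightarrow> 'o diagram" where
  "tensor X Y =
     \<lparr>pspace = (\<lambda>i. map_pmf prod_encode (pair_pmf (pspace X i) (pspace Y i))),
      red = (\<lambda>i j z. prod_encode (map_prod (red X i j) (red Y i j) (prod_decode z)))\<rparr>"

primrec tensor_power :: "'o diagram \<Rightarrow> nat \<Rightarrow> 'o diagram" where
  "tensor_power X 0 = neutral"
| "tensor_power X (Suc n) = tensor X (tensor_power X n)"

definition homogeneous :: "'o set \<Rightarrow> ('o \<times> 'o) set \<Rightarrow> 'o diagram \<Rightarrow> bool" where
  "homogeneous G r X \<longleftrightarrow>
     (\<forall>i\<in>G. \<forall>x\<in>set_pmf (pspace X i). \<forall>y\<in>set_pmf (pspace X i).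
        \<exists>f. diagram_isomorphism G r X X f \<and> f i x = y)"

definition Prob_h :: "'o set \<Rightarrow> ('o \<times> 'o) set \<Rightarrow> 'o diagram set" where
  "Prob_h G r = {X \<in> Prob G r. homogeneous G r X}"

definition Ent :: "nat pmf \<Rightarrow> real" where
  "Ent p = - (\<Sum>x\<in>set_pmf p. pmf p x * ln (pmf p x))"

text \<open>The \<open>\<ell>\<^sup>1\<close>-distance of the entropy vectors of two diagrams.\<close>

definition Ent_dist :: "'o set \<Rightarrow> 'o diagram \<Rightarrow> 'o diagram \<Rightarrow> real" where
  "Ent_dist G X Y = (\<Sum>i\<in>G. \<bar>Ent (pspace X i) - Ent (pspace Y i)\<bar>)"

definition two_fan ::
  "'o set \<Rightarrow> ('o \<times> 'o) set \<Rightarrow> 'o diagram \<Rightarrow> ('o \<Rightarrow> nat \<Rightarrow> nat) \<Rightarrow> 'o diagram \<Rightarrow>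
   ('o \<Rightarrow> nat \<Rightarrow> nat) \<Rightarrow> 'o diagram \<Rightarrow> bool" where
  "two_fan G r X f Z g Y \<longleftrightarrow>
     Z \<in> Prob G r \<and> diagram_morphism G r Z X f \<and> diagram_morphism G r Z Y g"

definition kd :: "'o set \<Rightarrow> 'o diagram \<Rightarrow> 'o diagram \<Rightarrow> 'o diagram \<Rightarrow> real" where
  "kd G X Z Y = Ent_dist G Z X + Ent_dist G Z Y"

definition intrinsic_dist :: "'o set \<Rightarrow> ('o \<times> 'o) set \<Rightarrow> 'o diagram \<Rightarrow> 'o diagram \<Rightarrow> real" where
  "intrinsic_dist G r X Y = Inf {kd G X Z Y | Z f g. two_fan G r X f Z g Y}"

definition kappa :: "'o set \<Rightarrow> ('o \<times> 'o) set \<Rightarrow> 'o diagram \<Rightarrow> 'o diagram \<Rightarrow> real" where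
  "kappa G r X Y =
     lim (\<lambda>n. intrinsic_dist G r (tensor_power X n) (tensor_power Y n) / real n)"

text \<open>The neutral element is only determined up to isomorphism.\<close>

definition QL ::
  "'o set \<Rightarrow> ('o \<times> 'o) set \<Rightarrow> (real \<Rightarrow> real) \<Rightarrow> 'o diagram set \<Rightarrow>
   ('o diagram \<Rightarrow> 'o diagram \<Rightarrow> real) \<Rightarrow> (nat \<Rightarrow> 'o diagram) set" where
  "QL G r \<phi> \<Gamma> d = {X.
     (\<forall>i. X i \<in> \<Gamma>) \<and> isomorphic_diagrams G r (X 0) neutral \<and>
     (\<exists>C\<ge>0. \<forall>m\<ge>1. \<forall>n\<ge>1. d (X (m + n)) (tensor (X m) (X n)) \<le> C * \<phi> (real (m + n)))}"

definition asymptotic_dist ::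
  "('o diagram \<Rightarrow> 'o diagram \<Rightarrow> real) \<Rightarrow> (nat \<Rightarrow> 'o diagram) \<Rightarrow> (nat \<Rightarrow> 'o diagram) \<Rightarrow> real" where
  "asymptotic_dist d X Y = lim (\<lambda>n. d (X n) (Y n) / real n)"

text \<open>Density with respect to a pseudo-distance \<open>d\<close>, which need not separate points.\<close>

definition dense_wrt :: "('x \<Rightarrow> 'x \<Rightarrow> real) \<Rightarrow> 'x set \<Rightarrow> 'x set \<Rightarrow> bool" where
  "dense_wrt d A B \<longleftrightarrow> A \<subseteq> B \<and> (\<forall>x\<in>B. \<forall>\<epsilon>>0. \<exists>a\<in>A. d x a < \<epsilon>)"

end

theory Submission
  imports Defs "HOL-Combinatorics.Multiset_Permutations"
begin

text \<open>
  A two-fan of diagrams is determined, up to lowering its cost, by a coupling of the two spaces over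
  the initial object of the indexing category; gluing and multiplying couplings makes the intrinsic
  distance a pseudo-distance for which the tensor product is 1-Lipschitz, and subadditivity passes
  this on to \<open>\<kappa>\<close>.

  The uniform distribution on the rearrangements of a typical sequence of length \<open>N\<close> over the initial
  space of \<open>X\<close> induces a homogeneous diagram \<open>H\<close>, since the symmetric group acts.  A random sequence
  can be turned into a rearrangement of the typical one by changing \<open>O(sqrt N)\<close> letters on average,
  and a Fano-type estimate turns this into \<open>k(X^N, H) = o(N)\<close>.

  For quasi-linear \<open>X\<close> the powers \<open>X(M)^n\<close> stay within \<open>O(n M^(3/4))\<close> of \<open>X(M n)\<close>.  So if \<open>M\<close> is large
  and \<open>H\<close> is homogeneous and close to \<open>X(M)^N\<close>, then \<open>n \<mapsto> H^(n div M N)\<close> is a homogeneous sequence,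
  linear up to a bounded error, at small asymptotic distance from \<open>X\<close>.
\<close>

subsection \<open>Entropy\<close>

text \<open>Pairwise common ancestors and finiteness give an object below all others. Over it a
  diagram is one finite probability space with a compatible family of functions, so all entropies
  involved are entropies of functions on a single sample space. The approximation has to work at
  every object simultaneously. Hamming distance suits this because coordinatewise reductions do not
  increase it, and permutations of positions suit it because they commute with such reductions. The
  entropy of a type class is never computed; only conditional entropies between coupled sequences
  are bounded. Quasi-linearity alone is delicate: comparing X(M n) with X(M)^n by splitting off one
  block at a time would add up errors of order M^(3/4) n^(7/4). Splitting in halves keeps the total
  linear in n, and per unit of length the loss is of order M^(-1/4), which is why a large M
  helps.\<close>

abbreviation expect :: "'a pmf \<Rightarrow> ('a \<Rightarrow> real) \<Rightarrow> real" where
  "expect p f \<equiv> measure_pmf.expectation p f"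

lemma expect_mono:
  assumes "finite (set_pmf p)" and "\<And>x. x \<in> set_pmf p \<Longrightarrow> f x \<le> g x"
  shows "expect p f \<le> expect p g"
  using assms by (intro integral_mono_AE integrable_measure_pmf_finite) (auto simp: AE_measure_pmf_iff)

lemma expect_cong:
  assumes "\<And>x. x \<in> set_pmf p \<Longrightarrow> f x = g x"
  shows "expect p f = expect p g"
  using assms by (intro integral_cong_AE) (auto simp: AE_measure_pmf_iff)

lemma expect_add:
  assumes "finite (set_pmf p)"
  shows "expect p (\<lambda>x. f x + g x) = expect p f + expect p g"
  using assms by (intro Bochner_Integration.integral_add integrable_measure_pmf_finite)

lemma expect_diff:
  assumes "finite (set_pmf p)"
  shows "expect p (\<lambda>x. f x - g x) = expect p f - expect p g"
  using assms by (intro Bochner_Integration.integral_diff integrable_measure_pmf_finite)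

text \<open>The entropy of the random variable \<open>f\<close> on the sample space
  \<open>p\<close>. As an expectation it can be compared pointwise, and a fixed \<open>p\<close>
  lets several variables share one space.\<close>

definition ent :: "'a pmf \<Rightarrow> ('a \<Rightarrow> 'b) \<Rightarrow> real" where
  "ent p f = expect p (\<lambda>x. - ln (pmf (map_pmf f p) (f x)))"

lemma Ent_map_pmf:
  assumes "finite (set_pmf p)"
  shows "Ent (map_pmf f p) = ent p f"
proof -
  have "Ent (map_pmf f p) = expect (map_pmf f p) (\<lambda>y. - ln (pmf (map_pmf f p) y))"
    unfolding Ent_def using assms
    by (subst integral_measure_pmf_real[where A = "set_pmf (map_pmf f p)"])
       (auto simp: sum_negf mult_ac)
  then show ?thesis by (simp add: ent_def)
qed

lemma ent_map_pmf: "ent (map_pmf g p) f = ent p (\<lambda>x. f (g x))"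
  by (simp add: ent_def pmf.map_comp o_def)

lemma pmf_map_self_pos: "x \<in> set_pmf p \<Longrightarrow> 0 < pmf (map_pmf f p) (f x)"
  by (rule pmf_positive) simp

text \<open>On atoms the fibre of \<open>g\<close> through \<open>x\<close> lies in the fibre of
  \<open>f\<close>, so the inequality already holds pointwise under the expectation.\<close>

lemma ent_mono:
  assumes "finite (set_pmf p)"
    and "\<And>x y. x \<in> set_pmf p \<Longrightarrow> y \<in> set_pmf p \<Longrightarrow> g x = g y \<Longrightarrow> f x = f y"
  shows "ent p f \<le> ent p g"
  unfolding ent_def
proof (rule expect_mono[OF assms(1)])
  fix x assume x: "x \<in> set_pmf p"
  have "pmf (map_pmf g p) (g x) \<le> pmf (map_pmf f p) (f x)"
    unfolding pmf_map
    by (rule measure_pmf.finite_measure_mono_AE)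
       (simp_all add: AE_measure_pmf_iff, use assms(2) x in blast)
  then show "- ln (pmf (map_pmf f p) (f x)) \<le> - ln (pmf (map_pmf g p) (g x))"
    using pmf_map_self_pos[OF x, of g] by simp
qed

lemma ent_eqI:
  assumes "finite (set_pmf p)"
    and "\<And>x y. x \<in> set_pmf p \<Longrightarrow> y \<in> set_pmf p \<Longrightarrow> g x = g y \<longleftrightarrow> f x = f y"
  shows "ent p f = ent p g"
  by (intro antisym ent_mono assms(1)) (use assms(2) in blast)+

text \<open>The left side is the conditional entropy H(V | U); it is bounded by the cross entropy
  with respect to any sub-probability kernel \<open>q\<close>, because ln s \<le> s - 1. The kernel
  stays free: a conditional law gives submodularity, a noisy channel gives the Fano-type
  bound.\<close>

lemma ent_gibbs:
  assumes fin: "finite (set_pmf p)"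
    and nonneg: "\<And>u v. 0 \<le> q u v"
    and pos: "\<And>x. x \<in> set_pmf p \<Longrightarrow> 0 < q (U x) (V x)"
    and le1: "\<And>u. u \<in> U ` set_pmf p \<Longrightarrow> (\<Sum>v\<in>V ` set_pmf p. q u v) \<le> 1"
  shows "ent p (\<lambda>x. (U x, V x)) - ent p U \<le> expect p (\<lambda>x. - ln (q (U x) (V x)))"
proof -
  let ?UV = "\<lambda>x. (U x, V x)"
  let ?W = "map_pmf ?UV p" and ?P = "map_pmf U p"
  have "ent p ?UV - ent p U - expect p (\<lambda>x. - ln (q (U x) (V x)))
      = expect p (\<lambda>x. - ln (pmf ?W (?UV x)) - - ln (pmf ?P (U x)) - - ln (q (U x) (V x)))"
    unfolding ent_def by (simp only: expect_diff[OF fin])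
  also have "\<dots> \<le> expect p (\<lambda>x. q (U x) (V x) * pmf ?P (U x) / pmf ?W (?UV x) - 1)"
  proof (rule expect_mono[OF fin])
    fix x assume x: "x \<in> set_pmf p"
    note pp = pmf_map_self_pos[OF x, of ?UV] pmf_map_self_pos[OF x, of U] pos[OF x]
    then have "- ln (pmf ?W (?UV x)) - - ln (pmf ?P (U x)) - - ln (q (U x) (V x))
        = ln (q (U x) (V x) * pmf ?P (U x) / pmf ?W (?UV x))"
      by (simp add: ln_mult ln_div)
    also have "\<dots> \<le> q (U x) (V x) * pmf ?P (U x) / pmf ?W (?UV x) - 1"
      using pp by (intro ln_le_minus_one) simp
    finally show "- ln (pmf ?W (?UV x)) - - ln (pmf ?P (U x)) - - ln (q (U x) (V x))
      \<le> q (U x) (V x) * pmf ?P (U x) / pmf ?W (?UV x) - 1" .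
  qed
  also have "\<dots> = expect p (\<lambda>x. q (U x) (V x) * pmf ?P (U x) / pmf ?W (?UV x)) - 1"
    by (simp add: expect_diff[OF fin])
  also have "\<dots> \<le> 0"
  proof -
    let ?F = "\<lambda>w. q (fst w) (snd w) * pmf ?P (fst w)"
    have 1: "expect p (\<lambda>x. q (U x) (V x) * pmf ?P (U x) / pmf ?W (?UV x)) = expect ?W (\<lambda>w. ?F w / pmf ?W w)"
      by simp
    have 2: "expect ?W (\<lambda>w. ?F w / pmf ?W w) = (\<Sum>w\<in>set_pmf ?W. ?F w / pmf ?W w * pmf ?W w)"
      by (rule integral_measure_pmf_real) (use fin in simp_all)
    have 3: "(\<Sum>w\<in>set_pmf ?W. ?F w / pmf ?W w * pmf ?W w) = (\<Sum>w\<in>set_pmf ?W. ?F w)"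
      by (rule sum.cong[OF refl]) (simp add: set_pmf_iff del: set_map_pmf)
    \<comment> \<open>The support of the joint law is enlarged to a full rectangle of values, so
      that the sum over \<open>v\<close> can be taken first.\<close>
    have 4: "(\<Sum>w\<in>set_pmf ?W. ?F w) \<le> (\<Sum>w\<in>(U ` set_pmf p) \<times> (V ` set_pmf p). ?F w)"
      by (rule sum_mono2) (use fin nonneg in auto)
    have 5: "(\<Sum>w\<in>(U ` set_pmf p) \<times> (V ` set_pmf p). ?F w)
        = (\<Sum>u\<in>U ` set_pmf p. (\<Sum>v\<in>V ` set_pmf p. q u v) * pmf ?P u)"
      by (simp add: sum.cartesian_product sum_distrib_right case_prod_beta')
    have 6: "(\<Sum>u\<in>U ` set_pmf p. (\<Sum>v\<in>V ` set_pmf p. q u v) * pmf ?P u) \<le> (\<Sum>u\<in>U ` set_pmf p. 1 * pmf ?P u)"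
      by (intro sum_mono mult_right_mono le1) auto
    have 7: "(\<Sum>u\<in>U ` set_pmf p. 1 * pmf ?P u) = 1"
      using sum_pmf_eq_1[of "U ` set_pmf p" ?P] fin by simp
    show ?thesis using 1 2 3 4 5 6 7 by linarith
  qed
  finally show ?thesis by simp
qed

text \<open>Gibbs' inequality for the pair (U, V) against W, with the conditional law of W given V
  as kernel; \<open>?q\<close> reads V off as \<open>snd u\<close>.\<close>

lemma ent_submodular:
  assumes fin: "finite (set_pmf p)"
  shows "ent p (\<lambda>x. (U x, V x, W x)) + ent p V \<le> ent p (\<lambda>x. (U x, V x)) + ent p (\<lambda>x. (V x, W x))"
proof -
  let ?S = "set_pmf p"
  let ?q = "\<lambda>u w. pmf (map_pmf (\<lambda>x. (V x, W x)) p) (snd u, w) / pmf (map_pmf V p) (snd u)"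
  have "ent p (\<lambda>x. ((U x, V x), W x)) - ent p (\<lambda>x. (U x, V x))
      \<le> expect p (\<lambda>x. - ln (?q (U x, V x) (W x)))"
  proof (rule ent_gibbs[OF fin])
    fix u assume "u \<in> (\<lambda>x. (U x, V x)) ` ?S"
    then obtain x where x: "x \<in> ?S" "snd u = V x" by auto
    have "(\<Sum>w\<in>W ` ?S. pmf (map_pmf (\<lambda>x. (V x, W x)) p) (V x, w))
        = measure_pmf.prob p (\<Union>w\<in>W ` ?S. (\<lambda>x. (V x, W x)) -` {(V x, w)})"
      unfolding pmf_map using fin
      by (intro measure_pmf.finite_measure_finite_Union[symmetric]) (auto simp: disjoint_family_on_def)
    also have "\<dots> \<le> measure_pmf.prob p (V -` {V x})"
      by (intro measure_pmf.finite_measure_mono) auto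
    finally have "(\<Sum>w\<in>W ` ?S. pmf (map_pmf (\<lambda>x. (V x, W x)) p) (V x, w)) \<le> pmf (map_pmf V p) (V x)"
      by (simp add: pmf_map)
    then show "(\<Sum>w\<in>W ` ?S. ?q u w) \<le> 1"
      using pmf_map_self_pos[OF x(1), of V] x(2)
      by (simp add: sum_divide_distrib[symmetric])
  next
    fix x assume "x \<in> ?S"
    then show "0 < ?q (U x, V x) (W x)"
      using pmf_map_self_pos[of x p "\<lambda>x. (V x, W x)"] pmf_map_self_pos[of x p V] by simp
  qed simp
  also have "\<dots> = expect p (\<lambda>x. - ln (pmf (map_pmf (\<lambda>x. (V x, W x)) p) (V x, W x))
                    - - ln (pmf (map_pmf V p) (V x)))"
  proof (rule expect_cong)
    fix x assume x: "x \<in> ?S"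
    show "- ln (?q (U x, V x) (W x)) = - ln (pmf (map_pmf (\<lambda>x. (V x, W x)) p) (V x, W x))
                    - - ln (pmf (map_pmf V p) (V x))"
      using pmf_map_self_pos[OF x, of "\<lambda>x. (V x, W x)"] pmf_map_self_pos[OF x, of V]
      by (simp add: ln_div)
  qed
  also have "\<dots> = ent p (\<lambda>x. (V x, W x)) - ent p V"
    unfolding ent_def by (simp only: expect_diff[OF fin])
  moreover have "ent p (\<lambda>x. (U x, V x, W x)) = ent p (\<lambda>x. ((U x, V x), W x))"
    by (rule ent_eqI[OF fin]) auto
  ultimately show ?thesis by simp
qed

lemma ent_pair_pmf:
  assumes p: "finite (set_pmf p)" and q: "finite (set_pmf q)"
  shows "ent (pair_pmf p q) (\<lambda>z. (f (fst z), g (snd z))) = ent p f + ent q g"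
proof -
  have fin: "finite (set_pmf (pair_pmf p q))" using p q by simp
  have m: "map_pmf (\<lambda>z. (f (fst z), g (snd z))) (pair_pmf p q) = pair_pmf (map_pmf f p) (map_pmf g q)"
    using map_pair[of f g p q] by (simp add: case_prod_beta')
  have "ent (pair_pmf p q) (\<lambda>z. (f (fst z), g (snd z)))
      = expect (pair_pmf p q) (\<lambda>z. - ln (pmf (map_pmf f p) (f (fst z))) + - ln (pmf (map_pmf g q) (g (snd z))))"
    unfolding ent_def m pmf_pair
  proof (rule expect_cong)
    fix z assume z: "z \<in> set_pmf (pair_pmf p q)"
    then have "fst z \<in> set_pmf p" "snd z \<in> set_pmf q" by auto
    from pmf_map_self_pos[OF this(1), of f] pmf_map_self_pos[OF this(2), of g]
    show "- ln (pmf (map_pmf f p) (f (fst z)) * pmf (map_pmf g q) (g (snd z)))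
       = - ln (pmf (map_pmf f p) (f (fst z))) + - ln (pmf (map_pmf g q) (g (snd z)))"
      by (simp add: ln_mult)
  qed
  also have "\<dots> = expect (map_pmf fst (pair_pmf p q)) (\<lambda>x. - ln (pmf (map_pmf f p) (f x)))
                + expect (map_pmf snd (pair_pmf p q)) (\<lambda>y. - ln (pmf (map_pmf g q) (g y)))"
    by (simp only: expect_add[OF fin] integral_map_pmf)
  also have "\<dots> = ent p f + ent q g"
    by (simp add: ent_def map_fst_pair_pmf map_snd_pair_pmf)
  finally show ?thesis .
qed

subsection \<open>Almost subadditive sequences\<close>

text \<open>Comparing fourth powers reduces numerical bounds on x^(3/4) to rational
  arithmetic.\<close>

lemma powr_three_quarters_ge:
  fixes x y :: real
  assumes "0 < y" "0 < x" "y ^ 4 \<le> x ^ 3"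
  shows "y \<le> x powr (3 / 4)"
proof -
  have "(x powr (3 / 4)) ^ 4 = x ^ 3" using assms(2) by (simp add: powr_power)
  then have "y ^ 4 \<le> (x powr (3 / 4)) ^ 4" using assms(3) by simp
  then show ?thesis by (rule power_mono_iff[THEN iffD1, rotated 3]) (use assms(1) in auto)
qed

text \<open>\<open>(1/3) powr (3/4) + (1/2) powr (3/4) > 51/50\<close> is where the constant 50 in the next lemmas comes from.\<close>

lemma halves_powr_three_quarters:
  assumes "2 \<le> n"
  shows "51 / 50 * real n powr (3 / 4) \<le> real (n div 2) powr (3 / 4) + real (n - n div 2) powr (3 / 4)"
proof -
  have "43 / 100 * real n powr (3 / 4) \<le> (1 / 3 * real n) powr (3 / 4)"
    unfolding powr_mult by (rule mult_right_mono[OF powr_three_quarters_ge]) (simp_all add: power_divide)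
  also have "\<dots> \<le> real (n div 2) powr (3 / 4)"
  proof (rule powr_mono2)
    have "n \<le> 3 * (n div 2)" using assms by linarith
    then have "real n \<le> real (3 * (n div 2))" by (rule of_nat_mono)
    then show "1 / 3 * real n \<le> real (n div 2)" by simp
  qed auto
  finally have 1: "43 / 100 * real n powr (3 / 4) \<le> real (n div 2) powr (3 / 4)" .
  have "59 / 100 * real n powr (3 / 4) \<le> (1 / 2 * real n) powr (3 / 4)"
    unfolding powr_mult by (rule mult_right_mono[OF powr_three_quarters_ge]) (simp_all add: power_divide)
  also have "\<dots> \<le> real (n - n div 2) powr (3 / 4)"
  proof (rule powr_mono2)
    have "n \<le> 2 * (n - n div 2)" by linarith
    then have "real n \<le> real (2 * (n - n div 2))" by (rule of_nat_mono)
    then show "1 / 2 * real n \<le> real (n - n div 2)" by simp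
  qed auto
  finally have 2: "59 / 100 * real n powr (3 / 4) \<le> real (n - n div 2) powr (3 / 4)" .
  from 1 2 show ?thesis by argo
qed

lemma almost_subadditive_le:
  fixes a :: "nat \<Rightarrow> real"
  assumes c: "0 \<le> c"
    and sub: "\<And>m n. 1 \<le> m \<Longrightarrow> 1 \<le> n \<Longrightarrow> a (m + n) \<le> a m + a n + c * real (m + n) powr (3 / 4)"
    and n: "1 \<le> n"
  shows "a n \<le> real n * (a 1 + 50 * c)"
proof -
  \<comment> \<open>The subtracted n^(3/4) closes the induction: by halving, the two parts together
    subtract at least 51 c n^(3/4), and the surplus c n^(3/4) pays exactly for the error term. At n
    = 1 the correction vanishes.\<close>
  have "a n \<le> real n * a 1 + 50 * c * (real n - real n powr (3 / 4))"
    using n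
  proof (induction n rule: less_induct)
    case (less n)
    show ?case
    proof (cases "n = 1")
      case False
      with less.prems have n: "2 \<le> n" by simp
      let ?k = "n div 2" and ?l = "n - n div 2"
      have kl: "1 \<le> ?k" "1 \<le> ?l" "?k < n" "?l < n" "?k + ?l = n" using n by auto
      then have re: "real ?k + real ?l = real n" by (metis of_nat_add)
      have "a n \<le> a ?k + a ?l + c * real n powr (3 / 4)" using sub[OF kl(1,2)] kl(5) by simp
      also have "\<dots> \<le> (real ?k * a 1 + 50 * c * (real ?k - real ?k powr (3 / 4)))
          + (real ?l * a 1 + 50 * c * (real ?l - real ?l powr (3 / 4))) + c * real n powr (3 / 4)"
        using less.IH[OF kl(3,1)] less.IH[OF kl(4,2)] by simp
      also have "\<dots> = real n * a 1 + 50 * c * real n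
          - 50 * c * (real ?k powr (3 / 4) + real ?l powr (3 / 4)) + c * real n powr (3 / 4)"
        unfolding re[symmetric] by (simp add: algebra_simps)
      also have "\<dots> \<le> real n * a 1 + 50 * c * real n
          - 50 * c * (51 / 50 * real n powr (3 / 4)) + c * real n powr (3 / 4)"
        using mult_left_mono[OF halves_powr_three_quarters[OF n], of "50 * c"] c by simp
      finally show ?thesis by (simp add: algebra_simps)
    qed simp
  qed
  moreover have "0 \<le> 50 * c * real n powr (3 / 4)" using c by simp
  ultimately show ?thesis by (simp add: algebra_simps)
qed

text \<open>Along the multiples of \<open>m\<close> the error factors as m^(3/4) (k + l)^(3/4), so
  the previous bound applies with constant c m^(3/4). Per unit of length this error is only of order
  m^(-1/4).\<close>

lemma almost_subadditive_mult_le: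
  fixes a :: "nat \<Rightarrow> real"
  assumes c: "0 \<le> c"
    and sub: "\<And>m n. 1 \<le> m \<Longrightarrow> 1 \<le> n \<Longrightarrow> a (m + n) \<le> a m + a n + c * real (m + n) powr (3 / 4)"
    and m: "1 \<le> m" and n: "1 \<le> n"
  shows "a (m * n) \<le> real n * (a m + 50 * (c * real m powr (3 / 4)))"
proof -
  have "a (m * n) \<le> real n * (a (m * 1) + 50 * (c * real m powr (3 / 4)))"
  proof (rule almost_subadditive_le[where a = "\<lambda>n. a (m * n)", OF _ _ n])
    fix k l :: nat assume "1 \<le> k" "1 \<le> l"
    then have "a (m * k + m * l) \<le> a (m * k) + a (m * l) + c * real (m * k + m * l) powr (3 / 4)"
      using m by (intro sub) auto
    also have "real (m * k + m * l) powr (3 / 4) = real m powr (3 / 4) * real (k + l) powr (3 / 4)"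
      by (subst powr_mult[symmetric]) (simp_all add: algebra_simps)
    finally show "a (m * (k + l)) \<le> a (m * k) + a (m * l) + c * real m powr (3 / 4) * real (k + l) powr (3 / 4)"
      by (simp add: distrib_left mult.assoc)
  qed (use c in simp)
  then show ?thesis by simp
qed

text \<open>The de Bruijn--Erdos extension of Fekete's lemma.\<close>

lemma almost_subadditive_tendsto:
  fixes a :: "nat \<Rightarrow> real"
  assumes c: "0 \<le> c" and nonneg: "\<And>n. 0 \<le> a n"
    and sub: "\<And>m n. 1 \<le> m \<Longrightarrow> 1 \<le> n \<Longrightarrow> a (m + n) \<le> a m + a n + c * real (m + n) powr (3 / 4)"
  shows "(\<lambda>n. a n / real n) \<longlonglongrightarrow> (INF m\<in>{1..}. a m / real m + 50 * c * real m powr (- (1 / 4)))"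
    (is "_ \<longlonglongrightarrow> (INF m\<in>_. ?b m)")
proof (rule LIMSEQ_I)
  let ?L = "INF m\<in>{1..}. ?b m"
  have bdd: "bdd_below (?b ` {1..})"
    using c nonneg by (intro bdd_belowI2[where m = 0]) auto
  fix e :: real assume e: "0 < e"
  have "\<exists>m\<in>{1..}. ?b m < ?L + e / 2"
    using e by (subst cINF_less_iff[symmetric]) (use bdd in auto)
  then obtain m where m: "1 \<le> m" "?b m < ?L + e / 2" by auto
  define A where "A = (\<Sum>j<m. a j)"
  \<comment> \<open>The first two summands serve the upper bound, where \<open>A\<close> dominates
    all possible remainders \<open>a j\<close>; the third serves the lower bound, obtained from
    \<open>?L \<le> ?b k\<close>.\<close>
  have "(\<lambda>k. A / real k + c * real k powr (- (1 / 4)) + 50 * c * real k powr (- (1 / 4))) \<longlonglongrightarrow> 0 + c * 0 + 50 * c * 0"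
    by (intro tendsto_intros tendsto_neg_powr filterlim_real_sequentially tendsto_divide_0[OF tendsto_const]
          filterlim_at_top_imp_at_infinity) auto
  then have "eventually (\<lambda>k. A / real k + c * real k powr (- (1 / 4)) + 50 * c * real k powr (- (1 / 4)) < e / 2) sequentially"
    using e by (intro order_tendstoD(2)[where a = "e / 2"]) auto
  moreover have "eventually (\<lambda>k. m \<le> k) sequentially" by (rule eventually_ge_at_top)
  ultimately have "eventually (\<lambda>k. norm (a k / real k - ?L) < e) sequentially"
  proof eventually_elim
    case (elim k)
    define q j where "q = k div m" and "j = k mod m"
    have k: "k = m * q + j" "1 \<le> q" "j < m" "0 < real k"
      using m elim unfolding q_def j_def by (auto simp: div_greater_zero_iff Suc_le_eq)
    have A: "0 \<le> A" unfolding A_def by (intro sum_nonneg nonneg)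
    have aj: "a j \<le> A" unfolding A_def using k(3) nonneg by (intro member_le_sum) auto
    have mq: "a (m * q) \<le> real q * (a m + 50 * (c * real m powr (3 / 4)))"
      by (rule almost_subadditive_mult_le[OF c sub m(1) k(2)])
    have ak: "a k \<le> a (m * q) + A + c * real k powr (3 / 4)"
    \<comment> \<open>\<open>sub\<close> speaks of positive arguments only, so exact multiples of
      \<open>m\<close> are treated apart.\<close>
    proof (cases "j = 0")
      case True
      then show ?thesis using k(1) A c by simp
    next
      case False
      then have "a (m * q + j) \<le> a (m * q) + a j + c * real (m * q + j) powr (3 / 4)"
        using m k(2) by (intro sub) auto
      then show ?thesis using k(1) aj by simp
    qed
    have m34: "real m powr (3 / 4) = real m * real m powr (- (1 / 4))"
      using m(1) powr_add[of "real m" 1 "- (1 / 4)"] by simp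
    have k34: "real k powr (3 / 4) = real k * real k powr (- (1 / 4))"
      using k(4) powr_add[of "real k" 1 "- (1 / 4)"] by simp
    have "real q * (a m + 50 * (c * real m powr (3 / 4))) = real (m * q) * ?b m"
      unfolding m34 using m(1) by (simp add: field_simps)
    also have "\<dots> \<le> real k * ?b m"
      using k(1) c nonneg by (intro mult_right_mono) auto
    finally have "a k \<le> real k * ?b m + A + c * (real k * real k powr (- (1 / 4)))"
      using ak mq unfolding k34 by linarith
    then have "a k / real k \<le> (real k * ?b m + A + c * (real k * real k powr (- (1 / 4)))) / real k"
      by (rule divide_right_mono) simp
    also have "\<dots> = ?b m + A / real k + c * real k powr (- (1 / 4))"
      using k(4) by (simp add: add_divide_distrib)
    finally have up: "a k / real k \<le> ?b m + A / real k + c * real k powr (- (1 / 4))" .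
    have "?L \<le> ?b k" using bdd elim m(1) by (intro cINF_lower) auto
    moreover have "0 \<le> A / real k" "0 \<le> c * real k powr (- (1 / 4))" using A c by auto
    ultimately have "\<bar>a k / real k - ?L\<bar> < e" using up m(2) elim(1) by linarith
    then show ?case by simp
  qed
  then show "\<exists>no. \<forall>n\<ge>no. norm (a n / real n - ?L) < e" by (simp add: eventually_sequentially)
qed

lemma subadditive_lim:
  fixes a :: "nat \<Rightarrow> real"
  assumes nonneg: "\<And>n. 0 \<le> a n"
    and sub: "\<And>m n. 1 \<le> m \<Longrightarrow> 1 \<le> n \<Longrightarrow> a (m + n) \<le> a m + a n"
  shows "(\<lambda>n. a n / real n) \<longlonglongrightarrow> lim (\<lambda>n. a n / real n)" "lim (\<lambda>n. a n / real n) \<le> a 1"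
proof -
  have *: "(\<lambda>n. a n / real n) \<longlonglongrightarrow> (INF m\<in>{1..}. a m / real m + 50 * 0 * real m powr (- (1 / 4)))"
    using nonneg sub by (intro almost_subadditive_tendsto) auto
  then show "(\<lambda>n. a n / real n) \<longlonglongrightarrow> lim (\<lambda>n. a n / real n)" using limI by force
  have "lim (\<lambda>n. a n / real n) = (INF m\<in>{1..}. a m / real m)" using limI[OF *] by simp
  also have "\<dots> \<le> a 1 / real 1"
    by (rule cINF_lower) (auto intro!: bdd_belowI2[where m = 0] simp: nonneg)
  finally show "lim (\<lambda>n. a n / real n) \<le> a 1" by simp
qed

subsection \<open>Couplings and the intrinsic distance\<close>

text \<open>The sum over the objects of H(U_i | V_i) + H(V_i | U_i), that is, the variation of
  information of the two families on the common sample space \<open>p\<close>.\<close>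

definition joint_cost :: "'o set \<Rightarrow> 'a pmf \<Rightarrow> ('o \<Rightarrow> 'a \<Rightarrow> 'b) \<Rightarrow> ('o \<Rightarrow> 'a \<Rightarrow> 'c) \<Rightarrow> real" where
  "joint_cost G p U V = (\<Sum>i\<in>G. 2 * ent p (\<lambda>x. (U i x, V i x)) - ent p (U i) - ent p (V i))"

lemma joint_cost_map_pmf:
  "joint_cost G (map_pmf h p) U V = joint_cost G p (\<lambda>i x. U i (h x)) (\<lambda>i x. V i (h x))"
  by (simp add: joint_cost_def ent_map_pmf)

lemma joint_cost_triangle:
  assumes fin: "finite (set_pmf p)"
  shows "joint_cost G p U W \<le> joint_cost G p U V + joint_cost G p V W"
  unfolding joint_cost_def sum.distrib[symmetric]
proof (rule sum_mono)
  fix i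
  have "ent p (\<lambda>x. (U i x, W i x)) \<le> ent p (\<lambda>x. (U i x, V i x, W i x))"
    by (rule ent_mono[OF fin]) auto
  then show "2 * ent p (\<lambda>x. (U i x, W i x)) - ent p (U i) - ent p (W i)
      \<le> 2 * ent p (\<lambda>x. (U i x, V i x)) - ent p (U i) - ent p (V i)
        + (2 * ent p (\<lambda>x. (V i x, W i x)) - ent p (V i) - ent p (W i))"
    using ent_submodular[OF fin, of "U i" "V i" "W i"] by linarith
qed

text \<open>Entropy sees only the partition into fibres. This is what removes the encodings of pairs
  and lists as natural numbers from all later estimates.\<close>

lemma joint_cost_eqI:
  assumes fin: "finite (set_pmf p)"
    and U: "\<And>i x y. i \<in> G \<Longrightarrow> x \<in> set_pmf p \<Longrightarrow> y \<in> set_pmf p \<Longrightarrow> U i x = U i y \<longleftrightarrow> U' i x = U' i y"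
    and V: "\<And>i x y. i \<in> G \<Longrightarrow> x \<in> set_pmf p \<Longrightarrow> y \<in> set_pmf p \<Longrightarrow> V i x = V i y \<longleftrightarrow> V' i x = V' i y"
  shows "joint_cost G p U V = joint_cost G p U' V'"
  unfolding joint_cost_def
proof (rule sum.cong[OF refl])
  fix i assume i: "i \<in> G"
  have "ent p (U i) = ent p (U' i)" "ent p (V i) = ent p (V' i)"
    "ent p (\<lambda>x. (U i x, V i x)) = ent p (\<lambda>x. (U' i x, V' i x))"
    by (rule ent_eqI[OF fin]; use U[OF i] V[OF i] in auto)+
  then show "2 * ent p (\<lambda>x. (U i x, V i x)) - ent p (U i) - ent p (V i)
    = 2 * ent p (\<lambda>x. (U' i x, V' i x)) - ent p (U' i) - ent p (V' i)" by simp
qed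

lemma joint_cost_pair_pmf:
  assumes p: "finite (set_pmf p)" and q: "finite (set_pmf q)"
  shows "joint_cost G (pair_pmf p q) (\<lambda>i z. (U i (fst z), U' i (snd z))) (\<lambda>i z. (V i (fst z), V' i (snd z)))
     = joint_cost G p U V + joint_cost G q U' V'"
  unfolding joint_cost_def sum.distrib[symmetric]
proof (rule sum.cong[OF refl])
  fix i
  have "ent (pair_pmf p q) (\<lambda>z. ((U i (fst z), U' i (snd z)), V i (fst z), V' i (snd z)))
      = ent (pair_pmf p q) (\<lambda>z. ((U i (fst z), V i (fst z)), (U' i (snd z), V' i (snd z))))"
    by (rule ent_eqI) (use p q in auto)
  also have "\<dots> = ent p (\<lambda>x. (U i x, V i x)) + ent q (\<lambda>x. (U' i x, V' i x))"
    by (rule ent_pair_pmf[OF p q, of "\<lambda>x. (U i x, V i x)" "\<lambda>x. (U' i x, V' i x)"])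
  finally show "2 * ent (pair_pmf p q) (\<lambda>z. ((U i (fst z), U' i (snd z)), V i (fst z), V' i (snd z)))
      - ent (pair_pmf p q) (\<lambda>z. (U i (fst z), U' i (snd z))) - ent (pair_pmf p q) (\<lambda>z. (V i (fst z), V' i (snd z)))
      = 2 * ent p (\<lambda>x. (U i x, V i x)) - ent p (U i) - ent p (V i)
        + (2 * ent q (\<lambda>x. (U' i x, V' i x)) - ent q (U' i) - ent q (V' i))"
    by (simp add: ent_pair_pmf[OF p q])
qed

text \<open>Equality of the two images is the lifting to measures of the relation
  \<open>g a = f b\<close>; a witness of this lifting is a measure on the fibre product.\<close>

lemma coupling_glue:
  assumes "map_pmf g p = map_pmf f q"
  obtains w where "map_pmf fst w = p" "map_pmf snd w = q" "\<And>z. z \<in> set_pmf w \<Longrightarrow> g (fst z) = f (snd z)"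
proof -
  have "rel_pmf (=) (map_pmf g p) (map_pmf f q)" using assms by (simp add: pmf.rel_eq)
  then have "rel_pmf (\<lambda>a b. g a = f b) p q" by (simp add: pmf.rel_map)
  then show thesis
  proof cases
    case (1 w)
    then show thesis by (intro that[of w]) (auto simp: case_prod_beta')
  qed
qed

lemma kd_nonneg: "0 \<le> kd G X Z Y"
  by (simp add: kd_def Ent_dist_def sum_nonneg)

section \<open>Diagrams presented by functions on a single sample space\<close>

locale initial_index =
  fixes G :: "'o set" and r :: "('o \<times> 'o) set" and ini :: 'o
  assumes finite_G: "finite G" and refl_r: "refl_on G r" and r_subset: "r \<subseteq> G \<times> G" and trans_r: "trans r"
    and ini: "ini \<in> G" and ini_le: "\<And>i. i \<in> G \<Longrightarrow> (ini, i) \<in> r"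
begin

text \<open>Every atom over \<open>i\<close> is some \<open>F i x\<close>, so the laws of a diagram
  can be checked on the sample space, where each composite of reductions is again some
  \<open>F j x\<close>.\<close>

lemma ProbI:
  assumes fin: "finite (set_pmf p)"
    and sp: "\<And>i. i \<in> G \<Longrightarrow> pspace X i = map_pmf (F i) p"
    and red: "\<And>i j x. (i, j) \<in> r \<Longrightarrow> x \<in> set_pmf p \<Longrightarrow> red X i j (F i x) = F j x"
  shows "X \<in> Prob G r"
  unfolding Prob_def mem_Collect_eq
proof (intro conjI ballI allI impI; clarsimp?)
  fix i assume "i \<in> G" then show "finite (set_pmf (pspace X i))" using fin by (simp add: sp)
next
  fix i j assume ij: "(i, j) \<in> r"
  then have "i \<in> G" "j \<in> G" using r_subset by auto
  then show "reduction (pspace X i) (pspace X j) (red X i j)"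
    by (auto simp: reduction_def sp pmf.map_comp intro!: pmf.map_cong0 red ij)
next
  fix i x assume i: "i \<in> G" "x \<in> set_pmf (pspace X i)"
  then show "red X i i x = x" using red refl_r by (auto simp: sp refl_on_def)
next
  fix i j k x assume ij: "(i, j) \<in> r" and jk: "(j, k) \<in> r" and x: "x \<in> set_pmf (pspace X i)"
  have "i \<in> G" using ij r_subset by auto
  with x obtain y where "y \<in> set_pmf p" "x = F i y" by (auto simp: sp)
  then show "red X j k (red X i j x) = red X i k x"
    using red[OF ij] red[OF jk] red[OF transD[OF trans_r ij jk]] by simp
qed

context
  fixes X assumes X: "X \<in> Prob G r"
begin

lemma finite_pspace: "i \<in> G \<Longrightarrow> finite (set_pmf (pspace X i))"
  using X by (simp add: Prob_def)

lemma pspace_eq: "i \<in> G \<Longrightarrow> pspace X i = map_pmf (red X ini i) (pspace X ini)"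
  using X ini_le[of i] by (fastforce simp: Prob_def reduction_def)

lemma red_red: "(i, j) \<in> r \<Longrightarrow> x \<in> set_pmf (pspace X ini) \<Longrightarrow> red X i j (red X ini i x) = red X ini j x"
  using X ini_le[of i] r_subset by (auto simp: Prob_def)

lemma red_ini: "x \<in> set_pmf (pspace X ini) \<Longrightarrow> red X ini ini x = x"
  using X ini by (simp add: Prob_def)

lemma Ent_pspace: "i \<in> G \<Longrightarrow> Ent (pspace X i) = ent (pspace X ini) (red X ini i)"
  using pspace_eq[of i] Ent_map_pmf[OF finite_pspace[OF ini]] by metis

end

lemma diagram_morphismI:
  assumes X: "X \<in> Prob G r"
    and Z: "\<And>i. i \<in> G \<Longrightarrow> pspace Z i = map_pmf (F i) p"
    and red: "\<And>i j x. (i, j) \<in> r \<Longrightarrow> x \<in> set_pmf p \<Longrightarrow> red Z i j (F i x) = F j x"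
    and g: "map_pmf g p = pspace X ini"
    and h: "\<And>i x. i \<in> G \<Longrightarrow> x \<in> set_pmf p \<Longrightarrow> h i (F i x) = red X ini i (g x)"
  shows "diagram_morphism G r Z X h"
  unfolding diagram_morphism_def
proof (intro conjI ballI; clarify?)
  fix i assume i: "i \<in> G"
  have "map_pmf (h i) (pspace Z i) = map_pmf (red X ini i) (map_pmf g p)"
    using h[OF i] by (auto simp: Z i pmf.map_comp intro!: pmf.map_cong0)
  then show "reduction (pspace Z i) (pspace X i) (h i)"
    using pspace_eq[OF X i] by (simp add: reduction_def g)
next
  fix i j z assume ij: "(i, j) \<in> r" and z: "z \<in> set_pmf (pspace Z i)"
  then have G: "i \<in> G" "j \<in> G" using r_subset by auto
  with z obtain x where x: "x \<in> set_pmf p" "z = F i x" by (auto simp: Z)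
  then have gx: "g x \<in> set_pmf (pspace X ini)" by (auto simp flip: g)
  show "h j (red Z i j z) = red X i j (h i z)"
    using x red[OF ij x(1)] h[OF G(1) x(1)] h[OF G(2) x(1)] red_red[OF X ij gx] by simp
qed

lemma intrinsic_dist_le:
  assumes "two_fan G r X f Z g Y"
  shows "intrinsic_dist G r X Y \<le> kd G X Z Y"
  unfolding intrinsic_dist_def
  using assms by (intro cInf_lower) (auto intro!: bdd_belowI[where m = 0] kd_nonneg)

text \<open>The top of the fan at \<open>i\<close> is the joint image of the coupling in the two
  spaces over \<open>i\<close>. Its entropy dominates both marginal entropies, so the absolute
  values in \<open>kd\<close> disappear.\<close>

lemma fan_of_coupling:
  assumes X: "X \<in> Prob G r" and Y: "Y \<in> Prob G r" and fin: "finite (set_pmf w)"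
    and f: "map_pmf f w = pspace X ini" and g: "map_pmf g w = pspace Y ini"
  shows "\<exists>Z h h'. two_fan G r X h Z h' Y \<and>
     kd G X Z Y = joint_cost G w (\<lambda>i x. red X ini i (f x)) (\<lambda>i x. red Y ini i (g x))"
proof -
  define F where "F i x = prod_encode (red X ini i (f x), red Y ini i (g x))" for i x
  define Z :: "'o diagram" where "Z = \<lparr>pspace = (\<lambda>i. map_pmf (F i) w),
    red = (\<lambda>i j z. prod_encode (map_prod (red X i j) (red Y i j) (prod_decode z)))\<rparr>"
  have sp: "pspace Z i = map_pmf (F i) w" for i by (simp add: Z_def)
  have fx: "f x \<in> set_pmf (pspace X ini)" "g x \<in> set_pmf (pspace Y ini)" if "x \<in> set_pmf w" for x
    using that by (auto simp flip: f g)
  have red: "red Z i j (F i x) = F j x" if "(i, j) \<in> r" "x \<in> set_pmf w" for i j x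
    using red_red[OF X that(1)] red_red[OF Y that(1)] fx[OF that(2)] by (simp add: Z_def F_def)
  have Z: "Z \<in> Prob G r" by (rule ProbI[OF fin, of Z F]) (auto simp: sp red)
  have 1: "diagram_morphism G r Z X (\<lambda>i z. fst (prod_decode z))"
    by (rule diagram_morphismI[OF X, of Z F w f]) (auto simp: sp red f, simp add: F_def)
  have 2: "diagram_morphism G r Z Y (\<lambda>i z. snd (prod_decode z))"
    by (rule diagram_morphismI[OF Y, of Z F w g]) (auto simp: sp red g, simp add: F_def)
  have "kd G X Z Y = joint_cost G w (\<lambda>i x. red X ini i (f x)) (\<lambda>i x. red Y ini i (g x))"
    unfolding kd_def Ent_dist_def joint_cost_def sum.distrib[symmetric]
  proof (rule sum.cong[OF refl])
    fix i assume i: "i \<in> G"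
    have "Ent (pspace Z i) = ent w (\<lambda>x. (red X ini i (f x), red Y ini i (g x)))"
      unfolding sp Ent_map_pmf[OF fin] by (rule ent_eqI[OF fin]) (auto simp: F_def)
    moreover have "Ent (pspace X i) = ent w (\<lambda>x. red X ini i (f x))"
      by (simp add: Ent_pspace[OF X i] ent_map_pmf flip: f)
    moreover have "Ent (pspace Y i) = ent w (\<lambda>x. red Y ini i (g x))"
      by (simp add: Ent_pspace[OF Y i] ent_map_pmf flip: g)
    moreover have "ent w (\<lambda>x. red X ini i (f x)) \<le> ent w (\<lambda>x. (red X ini i (f x), red Y ini i (g x)))"
      "ent w (\<lambda>x. red Y ini i (g x)) \<le> ent w (\<lambda>x. (red X ini i (f x), red Y ini i (g x)))"
      by (rule ent_mono[OF fin]; simp)+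
    ultimately show "\<bar>Ent (pspace Z i) - Ent (pspace X i)\<bar> + \<bar>Ent (pspace Z i) - Ent (pspace Y i)\<bar>
      = 2 * ent w (\<lambda>x. (red X ini i (f x), red Y ini i (g x))) - ent w (\<lambda>x. red X ini i (f x)) - ent w (\<lambda>x. red Y ini i (g x))"
      by linarith
  qed
  then show ?thesis using Z 1 2 by (auto simp: two_fan_def)
qed

lemma intrinsic_dist_le_joint_cost:
  assumes "X \<in> Prob G r" "Y \<in> Prob G r" "finite (set_pmf w)"
    and "map_pmf f w = pspace X ini" "map_pmf g w = pspace Y ini"
  shows "intrinsic_dist G r X Y \<le> joint_cost G w (\<lambda>i x. red X ini i (f x)) (\<lambda>i x. red Y ini i (g x))"
  using fan_of_coupling[OF assms] intrinsic_dist_le by metis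

lemma fans_nonempty:
  assumes "X \<in> Prob G r" "Y \<in> Prob G r"
  shows "{kd G X Z Y | Z f g. two_fan G r X f Z g Y} \<noteq> {}"
  using fan_of_coupling[OF assms, of "pair_pmf (pspace X ini) (pspace Y ini)" fst snd]
    finite_pspace[OF assms(1) ini] finite_pspace[OF assms(2) ini]
  by (auto simp: map_fst_pair_pmf map_snd_pair_pmf)

lemma intrinsic_dist_nonneg:
  assumes "X \<in> Prob G r" "Y \<in> Prob G r"
  shows "0 \<le> intrinsic_dist G r X Y"
  unfolding intrinsic_dist_def using fans_nonempty[OF assms]
  by (intro cInf_greatest) (auto simp: kd_nonneg)

text \<open>The converse passage: the initial space of a near-optimal fan is a coupling, and at each
  object the joint image is a quotient of the top of the fan, so the cost can only drop.\<close>

lemma coupling_of_intrinsic_dist_less: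
  assumes X: "X \<in> Prob G r" and Y: "Y \<in> Prob G r" and less: "intrinsic_dist G r X Y < e"
  obtains w :: "nat pmf" and f g where "finite (set_pmf w)"
    "map_pmf f w = pspace X ini" "map_pmf g w = pspace Y ini"
    "joint_cost G w (\<lambda>i x. red X ini i (f x)) (\<lambda>i x. red Y ini i (g x)) < e"
proof -
  obtain Z f g where fan: "two_fan G r X f Z g Y" and kd: "kd G X Z Y < e"
    using cInf_lessD[OF fans_nonempty[OF X Y] less[unfolded intrinsic_dist_def]] by auto
  let ?w = "pspace Z ini"
  have Z: "Z \<in> Prob G r" using fan by (simp add: two_fan_def)
  have f: "map_pmf (f i) (pspace Z i) = pspace X i" and g: "map_pmf (g i) (pspace Z i) = pspace Y i" if "i \<in> G" for i
    using fan that by (auto simp: two_fan_def diagram_morphism_def reduction_def)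
  have fi: "red X ini i (f ini x) = f i (red Z ini i x)" and gi: "red Y ini i (g ini x) = g i (red Z ini i x)"
    if "i \<in> G" "x \<in> set_pmf ?w" for i x
    using fan that ini_le[OF that(1)] by (auto simp: two_fan_def diagram_morphism_def)
  have fin: "finite (set_pmf ?w)" by (rule finite_pspace[OF Z ini])
  have "joint_cost G ?w (\<lambda>i x. red X ini i (f ini x)) (\<lambda>i x. red Y ini i (g ini x)) \<le> kd G X Z Y"
    unfolding kd_def Ent_dist_def joint_cost_def sum.distrib[symmetric]
  proof (rule sum_mono)
    fix i assume i: "i \<in> G"
    have "ent ?w (\<lambda>x. (red X ini i (f ini x), red Y ini i (g ini x))) \<le> ent ?w (red Z ini i)"
      by (rule ent_mono[OF fin]) (simp add: fi gi i)
    moreover have "Ent (pspace Z i) = ent ?w (red Z ini i)" by (rule Ent_pspace[OF Z i])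
    moreover have "Ent (pspace X i) = ent ?w (\<lambda>x. red X ini i (f ini x))"
      by (simp add: Ent_pspace[OF X i] ent_map_pmf flip: f[OF ini])
    moreover have "Ent (pspace Y i) = ent ?w (\<lambda>x. red Y ini i (g ini x))"
      by (simp add: Ent_pspace[OF Y i] ent_map_pmf flip: g[OF ini])
    ultimately show "2 * ent ?w (\<lambda>x. (red X ini i (f ini x), red Y ini i (g ini x)))
      - ent ?w (\<lambda>x. red X ini i (f ini x)) - ent ?w (\<lambda>x. red Y ini i (g ini x))
      \<le> \<bar>Ent (pspace Z i) - Ent (pspace X i)\<bar> + \<bar>Ent (pspace Z i) - Ent (pspace Y i)\<bar>"
      by linarith
  qed
  with kd show thesis using that[OF fin f[OF ini] g[OF ini]] by simp
qed

lemma intrinsic_dist_commute: "intrinsic_dist G r X Y = intrinsic_dist G r Y X"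
proof -
  have "{kd G X Z Y | Z f g. two_fan G r X f Z g Y} = {kd G Y Z X | Z f g. two_fan G r Y f Z g X}"
    by (auto simp: two_fan_def kd_def add.commute)
  then show ?thesis by (simp add: intrinsic_dist_def)
qed

lemma intrinsic_dist_triangle:
  assumes X: "X \<in> Prob G r" and Y: "Y \<in> Prob G r" and Z: "Z \<in> Prob G r"
  shows "intrinsic_dist G r X Z \<le> intrinsic_dist G r X Y + intrinsic_dist G r Y Z"
proof (rule field_le_epsilon)
  fix e :: real assume e: "0 < e"
  obtain p :: "nat pmf" and f g where p: "finite (set_pmf p)"
    "map_pmf f p = pspace X ini" "map_pmf g p = pspace Y ini"
    "joint_cost G p (\<lambda>i x. red X ini i (f x)) (\<lambda>i x. red Y ini i (g x)) < intrinsic_dist G r X Y + e / 2"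
    using coupling_of_intrinsic_dist_less[OF X Y, of "intrinsic_dist G r X Y + e / 2"] e by auto
  obtain q :: "nat pmf" and f' g' where q: "finite (set_pmf q)"
    "map_pmf f' q = pspace Y ini" "map_pmf g' q = pspace Z ini"
    "joint_cost G q (\<lambda>i x. red Y ini i (f' x)) (\<lambda>i x. red Z ini i (g' x)) < intrinsic_dist G r Y Z + e / 2"
    using coupling_of_intrinsic_dist_less[OF Y Z, of "intrinsic_dist G r Y Z + e / 2"] e by auto
  have "map_pmf g p = map_pmf f' q" using p q by simp
  then obtain w where w: "map_pmf fst w = p" "map_pmf snd w = q"
    "\<And>z. z \<in> set_pmf w \<Longrightarrow> g (fst z) = f' (snd z)" by (rule coupling_glue) blast
  have "set_pmf w \<subseteq> fst ` set_pmf w \<times> snd ` set_pmf w" by force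
  moreover have "fst ` set_pmf w = set_pmf p" "snd ` set_pmf w = set_pmf q" by (simp_all flip: w(1,2))
  ultimately have fin: "finite (set_pmf w)" using p(1) q(1) finite_subset by fastforce
  have "intrinsic_dist G r X Z \<le> joint_cost G w (\<lambda>i z. red X ini i (f (fst z))) (\<lambda>i z. red Z ini i (g' (snd z)))"
  proof (rule intrinsic_dist_le_joint_cost[OF X Z fin])
    show "map_pmf (\<lambda>z. f (fst z)) w = pspace X ini"
      unfolding p(2)[symmetric] w(1)[symmetric] by (simp add: pmf.map_comp o_def)
    show "map_pmf (\<lambda>z. g' (snd z)) w = pspace Z ini"
      unfolding q(3)[symmetric] w(2)[symmetric] by (simp add: pmf.map_comp o_def)
  qed
  also have "\<dots> \<le> joint_cost G w (\<lambda>i z. red X ini i (f (fst z))) (\<lambda>i z. red Y ini i (g (fst z)))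
      + joint_cost G w (\<lambda>i z. red Y ini i (g (fst z))) (\<lambda>i z. red Z ini i (g' (snd z)))"
    by (rule joint_cost_triangle[OF fin])
  \<comment> \<open>On the support of the glued measure both routes to the middle diagram
    agree.\<close>
  also have "joint_cost G w (\<lambda>i z. red Y ini i (g (fst z))) (\<lambda>i z. red Z ini i (g' (snd z)))
      = joint_cost G w (\<lambda>i z. red Y ini i (f' (snd z))) (\<lambda>i z. red Z ini i (g' (snd z)))"
    by (rule joint_cost_eqI[OF fin]) (simp_all add: w(3))
  also have "\<dots> = joint_cost G q (\<lambda>i x. red Y ini i (f' x)) (\<lambda>i x. red Z ini i (g' x))"
    unfolding w(2)[symmetric] joint_cost_map_pmf ..
  also have "joint_cost G w (\<lambda>i z. red X ini i (f (fst z))) (\<lambda>i z. red Y ini i (g (fst z)))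
      = joint_cost G p (\<lambda>i x. red X ini i (f x)) (\<lambda>i x. red Y ini i (g x))"
    unfolding w(1)[symmetric] joint_cost_map_pmf ..
  finally show "intrinsic_dist G r X Z \<le> intrinsic_dist G r X Y + intrinsic_dist G r Y Z + e"
    using p(4) q(4) by linarith
qed

text \<open>Couple \<open>X\<close> with its image under \<open>h\<close>: by injectivity both
  families have the same fibres at each object, so each determines the other. It serves for the
  associativity, commutativity and unit laws of the tensor product.\<close>

lemma intrinsic_dist_zeroI:
  assumes X: "X \<in> Prob G r" and Y: "Y \<in> Prob G r"
    and h: "map_pmf (h ini) (pspace X ini) = pspace Y ini"
    and red: "\<And>i x. i \<in> G \<Longrightarrow> x \<in> set_pmf (pspace X ini) \<Longrightarrow> red Y ini i (h ini x) = h i (red X ini i x)"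
    and inj: "\<And>i. i \<in> G \<Longrightarrow> inj_on (h i) (set_pmf (pspace X i))"
  shows "intrinsic_dist G r X Y = 0"
proof -
  let ?p = "pspace X ini"
  have fin: "finite (set_pmf ?p)" by (rule finite_pspace[OF X ini])
  have "intrinsic_dist G r X Y \<le> joint_cost G ?p (\<lambda>i x. red X ini i x) (\<lambda>i x. red Y ini i (h ini x))"
    using intrinsic_dist_le_joint_cost[OF X Y fin, of "\<lambda>x. x"] h by simp
  also have "\<dots> = joint_cost G ?p (\<lambda>i x. red X ini i x) (\<lambda>i x. red X ini i x)"
  proof (rule joint_cost_eqI[OF fin refl])
    fix i x y assume i: "i \<in> G" and xy: "x \<in> set_pmf ?p" "y \<in> set_pmf ?p"
    have "red X ini i x \<in> set_pmf (pspace X i)" "red X ini i y \<in> set_pmf (pspace X i)"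
      using xy by (auto simp: pspace_eq[OF X i])
    then show "red Y ini i (h ini x) = red Y ini i (h ini y) \<longleftrightarrow> red X ini i x = red X ini i y"
      using red[OF i xy(1)] red[OF i xy(2)] inj[OF i] by (auto simp: inj_on_def)
  qed
  also have "\<dots> = 0"
  proof -
    have "ent ?p (\<lambda>x. (red X ini i x, red X ini i x)) = ent ?p (red X ini i)" for i
      by (rule ent_eqI[OF fin]) auto
    then show ?thesis by (simp add: joint_cost_def)
  qed
  finally show ?thesis using intrinsic_dist_nonneg[OF X Y] by simp
qed

section \<open>Tensor products of diagrams and of couplings\<close>

lemma pspace_tensor: "pspace (tensor X Y) i = map_pmf prod_encode (pair_pmf (pspace X i) (pspace Y i))"
  by (simp add: tensor_def)

lemma red_tensor: "red (tensor X Y) i j (prod_encode (x, y)) = prod_encode (red X i j x, red Y i j y)"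
  by (simp add: tensor_def)

lemma tensor_in_Prob:
  assumes X: "X \<in> Prob G r" and Y: "Y \<in> Prob G r"
  shows "tensor X Y \<in> Prob G r"
proof (rule ProbI)
  show "finite (set_pmf (pair_pmf (pspace X ini) (pspace Y ini)))"
    using finite_pspace[OF X ini] finite_pspace[OF Y ini] by simp
  show "pspace (tensor X Y) i = map_pmf (\<lambda>z. prod_encode (red X ini i (fst z), red Y ini i (snd z)))
     (pair_pmf (pspace X ini) (pspace Y ini))" if "i \<in> G" for i
    unfolding pspace_tensor pspace_eq[OF X that] pspace_eq[OF Y that]
    by (simp add: pmf.map_comp o_def case_prod_beta' flip: map_pair)
  show "red (tensor X Y) i j (prod_encode (red X ini i (fst z), red Y ini i (snd z)))
     = prod_encode (red X ini j (fst z), red Y ini j (snd z))"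
    if "(i, j) \<in> r" "z \<in> set_pmf (pair_pmf (pspace X ini) (pspace Y ini))" for i j z
    using that red_red[OF X] red_red[OF Y] by (auto simp: red_tensor)
qed

lemma neutral_in_Prob: "neutral \<in> Prob G r"
  by (rule ProbI[of "return_pmf 0" _ "\<lambda>i x. x"]) (auto simp: neutral_def)

text \<open>The independent product of two near-optimal couplings couples the tensor products, and
  entropies of independent pairs add.\<close>

lemma intrinsic_dist_tensor_le:
  assumes A: "A \<in> Prob G r" and B: "B \<in> Prob G r" and C: "C \<in> Prob G r" and D: "D \<in> Prob G r"
  shows "intrinsic_dist G r (tensor A B) (tensor C D) \<le> intrinsic_dist G r A C + intrinsic_dist G r B D"
proof (rule field_le_epsilon)
  fix e :: real assume e: "0 < e"
  obtain p :: "nat pmf" and f g where p: "finite (set_pmf p)"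
    "map_pmf f p = pspace A ini" "map_pmf g p = pspace C ini"
    "joint_cost G p (\<lambda>i x. red A ini i (f x)) (\<lambda>i x. red C ini i (g x)) < intrinsic_dist G r A C + e / 2"
    using coupling_of_intrinsic_dist_less[OF A C, of "intrinsic_dist G r A C + e / 2"] e by auto
  obtain q :: "nat pmf" and f' g' where q: "finite (set_pmf q)"
    "map_pmf f' q = pspace B ini" "map_pmf g' q = pspace D ini"
    "joint_cost G q (\<lambda>i x. red B ini i (f' x)) (\<lambda>i x. red D ini i (g' x)) < intrinsic_dist G r B D + e / 2"
    using coupling_of_intrinsic_dist_less[OF B D, of "intrinsic_dist G r B D + e / 2"] e by auto
  let ?w = "pair_pmf p q"
  have fin: "finite (set_pmf ?w)" using p q by simp
  let ?f = "\<lambda>z. prod_encode (f (fst z), f' (snd z))" and ?g = "\<lambda>z. prod_encode (g (fst z), g' (snd z))"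
  have "intrinsic_dist G r (tensor A B) (tensor C D)
      \<le> joint_cost G ?w (\<lambda>i z. red (tensor A B) ini i (?f z)) (\<lambda>i z. red (tensor C D) ini i (?g z))"
  proof (rule intrinsic_dist_le_joint_cost[OF tensor_in_Prob[OF A B] tensor_in_Prob[OF C D] fin])
    show "map_pmf ?f ?w = pspace (tensor A B) ini"
      unfolding pspace_tensor p(2)[symmetric] q(2)[symmetric]
      by (simp add: pmf.map_comp o_def case_prod_beta' flip: map_pair)
    show "map_pmf ?g ?w = pspace (tensor C D) ini"
      unfolding pspace_tensor p(3)[symmetric] q(3)[symmetric]
      by (simp add: pmf.map_comp o_def case_prod_beta' flip: map_pair)
  qed
  also have "\<dots> = joint_cost G ?w
      (\<lambda>i z. (red A ini i (f (fst z)), red B ini i (f' (snd z)))) (\<lambda>i z. (red C ini i (g (fst z)), red D ini i (g' (snd z))))"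
    by (rule joint_cost_eqI[OF fin]) (simp_all add: red_tensor)
  also have "\<dots> = joint_cost G p (\<lambda>i x. red A ini i (f x)) (\<lambda>i x. red C ini i (g x))
      + joint_cost G q (\<lambda>i x. red B ini i (f' x)) (\<lambda>i x. red D ini i (g' x))"
    by (rule joint_cost_pair_pmf[OF p(1) q(1)])
  finally show "intrinsic_dist G r (tensor A B) (tensor C D) \<le> intrinsic_dist G r A C + intrinsic_dist G r B D + e"
    using p(4) q(4) by linarith
qed

end

subsection \<open>The asymptotic pseudo-distance\<close>

context initial_index
begin

text \<open>Replaces isomorphism of diagrams. The tensor product obeys its algebraic laws only up to
  re-encoding, and zero distance is a congruence for it that both distances respect.\<close>

definition equivalent :: "'o diagram \<Rightarrow> 'o diagram \<Rightarrow> bool" where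
  "equivalent X Y \<longleftrightarrow> X \<in> Prob G r \<and> Y \<in> Prob G r \<and> intrinsic_dist G r X Y = 0"

lemma equivalent_refl: "X \<in> Prob G r \<Longrightarrow> equivalent X X"
  unfolding equivalent_def by (auto intro!: intrinsic_dist_zeroI[where h = "\<lambda>i x. x"])

lemma equivalent_sym: "equivalent X Y \<Longrightarrow> equivalent Y X"
  unfolding equivalent_def by (metis intrinsic_dist_commute)

lemma equivalent_trans [trans]: "equivalent X Y \<Longrightarrow> equivalent Y Z \<Longrightarrow> equivalent X Z"
  unfolding equivalent_def using intrinsic_dist_triangle[of X Y Z] intrinsic_dist_nonneg[of X Z] by auto

lemma intrinsic_dist_equivalent:
  assumes "equivalent X X'" "equivalent Y Y'"
  shows "intrinsic_dist G r X Y = intrinsic_dist G r X' Y'"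
  using assms intrinsic_dist_triangle[of X X' Y] intrinsic_dist_triangle[of X' Y' Y]
    intrinsic_dist_triangle[of X' X Y'] intrinsic_dist_triangle[of X Y Y']
    intrinsic_dist_commute[of X X'] intrinsic_dist_commute[of Y Y']
  unfolding equivalent_def by auto

lemma equivalent_tensor:
  assumes "equivalent X X'" "equivalent Y Y'"
  shows "equivalent (tensor X Y) (tensor X' Y')"
  using assms intrinsic_dist_tensor_le[of X Y X' Y'] intrinsic_dist_nonneg[of "tensor X Y" "tensor X' Y'"]
  unfolding equivalent_def by (auto simp: tensor_in_Prob)

lemma pspace_neutral: "pspace neutral i = return_pmf 0"
  by (simp add: neutral_def)

lemma red_neutral: "red neutral i j x = x"
  by (simp add: neutral_def)

lemma equivalent_tensor_neutral: "X \<in> Prob G r \<Longrightarrow> equivalent (tensor X neutral) X"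
  unfolding equivalent_def
  by (auto intro!: intrinsic_dist_zeroI[where h = "\<lambda>i z. fst (prod_decode z)"] tensor_in_Prob neutral_in_Prob
      simp: pspace_tensor red_tensor pmf.map_comp o_def map_fst_pair_pmf inj_on_def pspace_neutral red_neutral)

lemma equivalent_tensor_commute:
  assumes X: "X \<in> Prob G r" and Y: "Y \<in> Prob G r"
  shows "equivalent (tensor X Y) (tensor Y X)"
proof -
  let ?h = "\<lambda>(i::'o) z. prod_encode (snd (prod_decode z), fst (prod_decode z))"
  have "intrinsic_dist G r (tensor X Y) (tensor Y X) = 0"
  proof (rule intrinsic_dist_zeroI[where h = ?h])
    show "map_pmf (?h ini) (pspace (tensor X Y) ini) = pspace (tensor Y X) ini"
      by (simp add: pspace_tensor pmf.map_comp o_def case_prod_beta' pair_commute_pmf[of "pspace Y ini"])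
  qed (auto simp: pspace_tensor red_tensor inj_on_def X Y tensor_in_Prob)
  then show ?thesis by (simp add: equivalent_def X Y tensor_in_Prob)
qed

lemma equivalent_tensor_assoc:
  assumes X: "X \<in> Prob G r" and Y: "Y \<in> Prob G r" and Z: "Z \<in> Prob G r"
  shows "equivalent (tensor (tensor X Y) Z) (tensor X (tensor Y Z))"
proof -
  let ?h = "\<lambda>(i::'o) z. let (w, c) = prod_decode z; (a, b) = prod_decode w in prod_encode (a, prod_encode (b, c))"
  have "intrinsic_dist G r (tensor (tensor X Y) Z) (tensor X (tensor Y Z)) = 0"
  proof (rule intrinsic_dist_zeroI[where h = ?h])
    show "map_pmf (?h ini) (pspace (tensor (tensor X Y) Z) ini) = pspace (tensor X (tensor Y Z)) ini"
      by (simp add: pspace_tensor pair_map_pmf1 pair_map_pmf2 pair_pair_pmf pmf.map_comp o_def case_prod_beta' apfst_def apsnd_def map_prod_def)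
  qed (auto simp: pspace_tensor red_tensor inj_on_def X Y Z tensor_in_Prob)
  then show ?thesis by (simp add: equivalent_def X Y Z tensor_in_Prob)
qed

lemma equivalent_tensor_interchange:
  assumes "A \<in> Prob G r" "B \<in> Prob G r" "C \<in> Prob G r" "D \<in> Prob G r"
  shows "equivalent (tensor (tensor A B) (tensor C D)) (tensor (tensor A C) (tensor B D))"
proof -
  note P = assms tensor_in_Prob
  have "equivalent (tensor (tensor A B) (tensor C D)) (tensor A (tensor B (tensor C D)))"
    by (intro equivalent_tensor_assoc P)
  also have "equivalent \<dots> (tensor A (tensor (tensor B C) D))"
    by (intro equivalent_tensor equivalent_refl equivalent_sym[OF equivalent_tensor_assoc] P)
  also have "equivalent \<dots> (tensor A (tensor (tensor C B) D))"
    by (intro equivalent_tensor equivalent_refl equivalent_tensor_commute P)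
  also have "equivalent \<dots> (tensor A (tensor C (tensor B D)))"
    by (intro equivalent_tensor equivalent_refl equivalent_tensor_assoc P)
  also have "equivalent \<dots> (tensor (tensor A C) (tensor B D))"
    by (intro equivalent_sym[OF equivalent_tensor_assoc] P)
  finally show ?thesis .
qed

lemma tensor_power_in_Prob: "X \<in> Prob G r \<Longrightarrow> tensor_power X n \<in> Prob G r"
  by (induction n) (auto intro: neutral_in_Prob tensor_in_Prob)

lemma equivalent_neutral_tensor: "X \<in> Prob G r \<Longrightarrow> equivalent (tensor neutral X) X"
  using equivalent_trans equivalent_tensor_commute equivalent_tensor_neutral neutral_in_Prob by blast

lemma equivalent_tensor_power_add:
  assumes X: "X \<in> Prob G r"
  shows "equivalent (tensor_power X (m + n)) (tensor (tensor_power X m) (tensor_power X n))"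
proof (induction m)
  case 0
  show ?case by (simp add: equivalent_sym[OF equivalent_neutral_tensor] tensor_power_in_Prob X)
next
  case (Suc m)
  have "equivalent (tensor_power X (Suc m + n)) (tensor X (tensor (tensor_power X m) (tensor_power X n)))"
    using Suc by (simp add: equivalent_tensor equivalent_refl X)
  also have "equivalent \<dots> (tensor (tensor X (tensor_power X m)) (tensor_power X n))"
    by (intro equivalent_sym[OF equivalent_tensor_assoc] tensor_power_in_Prob X)
  finally show ?case by simp
qed

lemma equivalent_tensor_power_tensor:
  assumes X: "X \<in> Prob G r" and Y: "Y \<in> Prob G r"
  shows "equivalent (tensor_power (tensor X Y) n) (tensor (tensor_power X n) (tensor_power Y n))"
proof (induction n)
  case 0
  show ?case by (simp add: equivalent_sym[OF equivalent_neutral_tensor] neutral_in_Prob)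
next
  case (Suc n)
  have "equivalent (tensor_power (tensor X Y) (Suc n)) (tensor (tensor X Y) (tensor (tensor_power X n) (tensor_power Y n)))"
    using Suc by (simp add: equivalent_tensor equivalent_refl tensor_in_Prob X Y)
  also have "equivalent \<dots> (tensor (tensor X (tensor_power X n)) (tensor Y (tensor_power Y n)))"
    by (intro equivalent_tensor_interchange tensor_power_in_Prob X Y)
  finally show ?case by simp
qed

lemma equivalent_tensor_power_one: "X \<in> Prob G r \<Longrightarrow> equivalent (tensor_power X 1) X"
  by (simp add: equivalent_tensor_neutral)

text \<open>Powers split up to equivalence, so the distances of powers are subadditive. Hence the
  \<open>lim\<close> defining \<open>kappa\<close> is a genuine limit, bounded by the first term.
  That term involves \<open>tensor_power X 1\<close>, a product with \<open>neutral\<close>, which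
  is merely equivalent to \<open>X\<close>.\<close>

lemma kappa_tendsto_le:
  assumes X: "X \<in> Prob G r" and Y: "Y \<in> Prob G r"
  shows "(\<lambda>n. intrinsic_dist G r (tensor_power X n) (tensor_power Y n) / real n) \<longlonglongrightarrow> kappa G r X Y"
    and "kappa G r X Y \<le> intrinsic_dist G r X Y"
proof -
  let ?a = "\<lambda>n. intrinsic_dist G r (tensor_power X n) (tensor_power Y n)"
  have nonneg: "0 \<le> ?a n" for n by (intro intrinsic_dist_nonneg tensor_power_in_Prob X Y)
  have sub: "?a (m + n) \<le> ?a m + ?a n" for m n
    using intrinsic_dist_equivalent[OF equivalent_tensor_power_add[OF X] equivalent_tensor_power_add[OF Y], of m n m n]
      intrinsic_dist_tensor_le[OF tensor_power_in_Prob[OF X] tensor_power_in_Prob[OF X]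
        tensor_power_in_Prob[OF Y] tensor_power_in_Prob[OF Y], of m n m n] by simp
  show "(\<lambda>n. ?a n / real n) \<longlonglongrightarrow> kappa G r X Y"
    unfolding kappa_def by (rule subadditive_lim(1)[of ?a, OF nonneg sub])
  have "?a 1 = intrinsic_dist G r X Y"
    by (intro intrinsic_dist_equivalent equivalent_tensor_power_one X Y)
  then show "kappa G r X Y \<le> intrinsic_dist G r X Y"
    unfolding kappa_def using subadditive_lim(2)[of ?a, OF nonneg sub] by simp
qed

lemma kappa_nonneg: "X \<in> Prob G r \<Longrightarrow> Y \<in> Prob G r \<Longrightarrow> 0 \<le> kappa G r X Y"
  by (rule LIMSEQ_le_const[OF kappa_tendsto_le(1)])
     (auto intro!: exI divide_nonneg_nonneg intrinsic_dist_nonneg tensor_power_in_Prob)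

lemma kappa_commute: "kappa G r X Y = kappa G r Y X"
  unfolding kappa_def by (subst intrinsic_dist_commute) simp

lemma kappa_triangle:
  assumes "X \<in> Prob G r" "Y \<in> Prob G r" "Z \<in> Prob G r"
  shows "kappa G r X Z \<le> kappa G r X Y + kappa G r Y Z"
proof (rule LIMSEQ_le[OF kappa_tendsto_le(1)[OF assms(1,3)] tendsto_add[OF kappa_tendsto_le(1)[OF assms(1,2)] kappa_tendsto_le(1)[OF assms(2,3)]]])
  show "\<exists>N. \<forall>n\<ge>N. intrinsic_dist G r (tensor_power X n) (tensor_power Z n) / real n
    \<le> intrinsic_dist G r (tensor_power X n) (tensor_power Y n) / real n
      + intrinsic_dist G r (tensor_power Y n) (tensor_power Z n) / real n"
    unfolding add_divide_distrib[symmetric]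
    by (intro exI allI impI divide_right_mono intrinsic_dist_triangle tensor_power_in_Prob assms) auto
qed

lemma kappa_tensor_le:
  assumes A: "A \<in> Prob G r" and B: "B \<in> Prob G r" and C: "C \<in> Prob G r" and D: "D \<in> Prob G r"
  shows "kappa G r (tensor A B) (tensor C D) \<le> kappa G r A C + kappa G r B D"
proof (rule LIMSEQ_le[OF kappa_tendsto_le(1)[OF tensor_in_Prob[OF A B] tensor_in_Prob[OF C D]]
      tendsto_add[OF kappa_tendsto_le(1)[OF A C] kappa_tendsto_le(1)[OF B D]]])
  have "intrinsic_dist G r (tensor_power (tensor A B) n) (tensor_power (tensor C D) n)
    \<le> intrinsic_dist G r (tensor_power A n) (tensor_power C n) + intrinsic_dist G r (tensor_power B n) (tensor_power D n)" for n
    unfolding intrinsic_dist_equivalent[OF equivalent_tensor_power_tensor[OF A B] equivalent_tensor_power_tensor[OF C D]]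
    by (intro intrinsic_dist_tensor_le tensor_power_in_Prob A B C D)
  then show "\<exists>N. \<forall>n\<ge>N. intrinsic_dist G r (tensor_power (tensor A B) n) (tensor_power (tensor C D) n) / real n
    \<le> intrinsic_dist G r (tensor_power A n) (tensor_power C n) / real n
      + intrinsic_dist G r (tensor_power B n) (tensor_power D n) / real n"
    unfolding add_divide_distrib[symmetric]
    by (intro exI allI impI divide_right_mono) auto
qed

lemma kappa_equivalent:
  assumes "equivalent X Y" shows "kappa G r X Y = 0"
  using assms kappa_nonneg[of X Y] kappa_tendsto_le(2)[of X Y] unfolding equivalent_def by auto

lemma kappa_cong:
  assumes "equivalent X X'" "equivalent Y Y'"
  shows "kappa G r X Y = kappa G r X' Y'"
proof -
  have P: "X \<in> Prob G r" "X' \<in> Prob G r" "Y \<in> Prob G r" "Y' \<in> Prob G r"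
    using assms by (auto simp: equivalent_def)
  note 0 = kappa_equivalent[OF assms(1)] kappa_equivalent[OF assms(2)]
  show ?thesis
    using kappa_triangle[OF P(1,2,3)] kappa_triangle[OF P(2,4,3)] kappa_triangle[OF P(2,1,4)]
      kappa_triangle[OF P(1,3,4)] 0 kappa_commute[of X X'] kappa_commute[of Y Y'] by linarith
qed

text \<open>The two exponents are split independently: one use isolates a surplus factor on one
  side, the other compares a block of \<open>N\<close> factors with a single factor.\<close>

lemma kappa_tensor_power_add_le:
  assumes X: "X \<in> Prob G r" and Y: "Y \<in> Prob G r"
  shows "kappa G r (tensor_power X (a + b)) (tensor_power Y (c + d))
     \<le> kappa G r (tensor_power X a) (tensor_power Y c) + kappa G r (tensor_power X b) (tensor_power Y d)"
  unfolding kappa_cong[OF equivalent_tensor_power_add[OF X] equivalent_tensor_power_add[OF Y]]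
  by (intro kappa_tensor_le tensor_power_in_Prob X Y)

end

subsection \<open>Typical sequences\<close>

definition hamming :: "'a list \<Rightarrow> 'a list \<Rightarrow> nat" where
  "hamming xs ys = length (filter (\<lambda>z. fst z \<noteq> snd z) (zip xs ys))"

lemma hamming_simps [simp]:
  "hamming [] ys = 0" "hamming (x # xs) (y # ys) = (if x = y then 0 else 1) + hamming xs ys"
  by (auto simp: hamming_def)

lemma hamming_commute: "length xs = length ys \<Longrightarrow> hamming xs ys = hamming ys xs"
  by (induction xs ys rule: list_induct2) auto

lemma hamming_map_le: "length xs = length ys \<Longrightarrow> hamming (map f xs) (map f ys) \<le> hamming xs ys"
  by (induction xs ys rule: list_induct2) auto

lemma hamming_permute_list:
  assumes "\<sigma> permutes {..<length xs}" "length xs = length ys"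
  shows "hamming (permute_list \<sigma> xs) (permute_list \<sigma> ys) = hamming xs ys"
proof -
  have "size (filter_mset P (mset (permute_list \<sigma> (zip xs ys)))) = size (filter_mset P (mset (zip xs ys)))" for P
    using assms by simp
  then show ?thesis
    unfolding hamming_def permute_list_zip[OF assms(1) refl assms(2), symmetric]
    by (simp only: mset_filter[symmetric] size_mset)
qed

text \<open>A greedy choice: keep the letter \<open>x\<close> while \<open>M\<close> still offers
  it, otherwise pay one mismatch with a letter that the rest of the sequence can spare.\<close>

lemma rearrangement_hamming_le:
  assumes "length xs = size M"
  shows "\<exists>ys. mset ys = M \<and> hamming xs ys \<le> size (mset xs - M)"
  using assms
proof (induction xs arbitrary: M)
  case (Cons x xs)
  have "\<exists>b. b \<in># M \<and> (if x = b then 0 else 1) + size (mset xs - (M - {#b#})) \<le> size (mset (x # xs) - M)"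
  proof (cases "x \<in># M")
    case True
    then obtain M' where "M = add_mset x M'" by (metis multi_member_split)
    then show ?thesis by (intro exI[of _ x]) auto
  next
    case False
    \<comment> \<open>\<open>M\<close> has one element more than \<open>xs\<close>, so some letter
      \<open>b\<close> is more frequent in \<open>M\<close> than in \<open>xs\<close>. Spending it
      here does not increase the excess of \<open>xs\<close>.\<close>
    have "\<not> M \<subseteq># mset xs" using Cons.prems size_mset_mono[of M "mset xs"] by auto
    then obtain b where b: "count (mset xs) b < count M b" by (auto simp: subseteq_mset_def not_le)
    then have "mset xs - (M - {#b#}) = mset xs - M" by (auto simp: multiset_eq_iff)
    moreover have "mset (x # xs) - M = add_mset x (mset xs - M)"
      using False by (auto simp: multiset_eq_iff not_in_iff)
    moreover have "b \<in># M" using b by (metis count_eq_zero_iff not_less_zero)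
    ultimately show ?thesis by (intro exI[of _ b]) auto
  qed
  then obtain b where b: "b \<in># M"
    "(if x = b then 0 else 1) + size (mset xs - (M - {#b#})) \<le> size (mset (x # xs) - M)" by blast
  have "length xs = size (M - {#b#})" using Cons.prems b(1) by (simp add: size_Diff_singleton)
  then obtain ys where "mset ys = M - {#b#}" "hamming xs ys \<le> size (mset xs - (M - {#b#}))"
    using Cons.IH by blast
  then show ?case using b by (intro exI[of _ "b # ys"]) (auto split: if_splits)
qed auto

section \<open>Letter counts of independent samples\<close>

lemma replicate_pmf_Suc: "replicate_pmf (Suc n) p = map_pmf (\<lambda>(x, xs). x # xs) (pair_pmf p (replicate_pmf n p))"
  by (simp add: pair_pmf_def map_bind_pmf)

lemma finite_set_replicate_pmf:
  assumes "finite (set_pmf p)"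
  shows "finite (set_pmf (replicate_pmf n p))"
  using finite_lists_length_eq[OF assms, of n] by (simp add: set_replicate_pmf in_lists_conv_set subset_code(1) conj_commute)

lemma expect_replicate_pmf_Suc:
  assumes "finite (set_pmf p)"
  shows "expect (replicate_pmf (Suc n) p) F = expect p (\<lambda>x. expect (replicate_pmf n p) (\<lambda>xs. F (x # xs)))"
proof -
  have "replicate_pmf (Suc n) p = p \<bind> (\<lambda>x. map_pmf ((#) x) (replicate_pmf n p))"
    by (simp add: map_pmf_def)
  also have "expect \<dots> F = (\<Sum>x\<in>set_pmf p. pmf p x *\<^sub>R expect (map_pmf ((#) x) (replicate_pmf n p)) F)"
    by (rule pmf_expectation_bind) (use assms finite_set_replicate_pmf in auto)
  also have "\<dots> = expect p (\<lambda>x. expect (replicate_pmf n p) (\<lambda>xs. F (x # xs)))"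
    by (subst integral_measure_pmf_real[OF assms]) (auto simp: mult_ac)
  finally show ?thesis .
qed

text \<open>The deviation is a sum of independent centred terms \<open>d\<close> of size at most 1;
  the cross term has mean zero, so each letter adds at most 1 to the variance.\<close>

lemma expect_count_deviation:
  fixes p :: "'a pmf" and a :: 'a
  assumes fin: "finite (set_pmf p)"
  defines "Z \<equiv> (\<lambda>n xs. real (count (mset xs) a) - real n * pmf p a)"
  shows "expect (replicate_pmf n p) (Z n) = 0"
    and "expect (replicate_pmf n p) (\<lambda>xs. (Z n xs)\<^sup>2) \<le> real n"
proof -
  define d where "d x = (if x = a then 1 else 0) - pmf p a" for x
  have Z: "Z (Suc n) (x # xs) = d x + Z n xs" for n x xs
    by (auto simp: Z_def d_def algebra_simps)
  have fr: "finite (set_pmf (replicate_pmf n p))" for n by (rule finite_set_replicate_pmf[OF fin])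
  have "expect p (\<lambda>x. if x = a then 1 else 0) = pmf p a"
    by (subst integral_measure_pmf_real[of "{a}"]) (auto split: if_splits)
  then have d0: "expect p d = 0" unfolding d_def by (simp add: expect_diff[OF fin])
  have d1: "(d x)\<^sup>2 \<le> 1" for x
  proof -
    have "\<bar>d x\<bar> \<le> 1" unfolding d_def using pmf_nonneg[of p a] pmf_le_1[of p a] by (auto simp del: pmf_nonneg)
    then show ?thesis by (simp add: abs_square_le_1)
  qed
  show Z0: "expect (replicate_pmf n p) (Z n) = 0" for n
  proof (induction n)
    case (Suc n)
    then show ?case
      using d0 by (simp add: expect_replicate_pmf_Suc[OF fin] Z expect_add[OF fr] del: replicate_pmf.simps)
  qed (simp add: Z_def)
  show "expect (replicate_pmf n p) (\<lambda>xs. (Z n xs)\<^sup>2) \<le> real n"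
  proof (induction n)
    case (Suc n)
    have "expect (replicate_pmf n p) (\<lambda>xs. (Z (Suc n) (x # xs))\<^sup>2) \<le> 1 + real n" for x
    proof -
      have "expect (replicate_pmf n p) (\<lambda>xs. (Z (Suc n) (x # xs))\<^sup>2)
          = expect (replicate_pmf n p) (\<lambda>xs. ((d x)\<^sup>2 + 2 * d x * Z n xs) + (Z n xs)\<^sup>2)"
        unfolding Z by (simp add: power2_sum algebra_simps)
      also have "\<dots> = (d x)\<^sup>2 + 2 * d x * expect (replicate_pmf n p) (Z n) + expect (replicate_pmf n p) (\<lambda>xs. (Z n xs)\<^sup>2)"
        by (simp add: expect_add[OF fr])
      also have "\<dots> \<le> 1 + real n" using Z0[of n] Suc d1[of x] by simp
      finally show ?thesis .
    qed
    then have "expect p (\<lambda>x. expect (replicate_pmf n p) (\<lambda>xs. (Z (Suc n) (x # xs))\<^sup>2)) \<le> expect p (\<lambda>x. 1 + real n)"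
      by (intro expect_mono fin)
    then show ?case by (simp add: expect_replicate_pmf_Suc[OF fin] del: replicate_pmf.simps)
  qed (simp add: Z_def)
qed

lemma expect_abs_count_deviation_le:
  assumes fin: "finite (set_pmf p)"
  shows "expect (replicate_pmf n p) (\<lambda>xs. \<bar>real (count (mset xs) a) - real n * pmf p a\<bar>) \<le> sqrt (real n)"
proof (cases "n = 0")
  case False
  let ?Z = "\<lambda>xs. real (count (mset xs) a) - real n * pmf p a"
  define s where "s = sqrt (real n)"
  have s: "0 < s" "real n = s * s" using False by (auto simp: s_def)
  \<comment> \<open>The inequality of arithmetic and geometric means takes the place of
    Cauchy-Schwarz; s = sqrt n balances the two summands once the second moment is at most
    n.\<close>
  have "\<bar>z\<bar> \<le> z\<^sup>2 / (2 * s) + s / 2" for z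
  proof -
    have "0 \<le> (\<bar>z\<bar> - s)\<^sup>2" by simp
    then have "2 * s * \<bar>z\<bar> \<le> z\<^sup>2 + s * s" by (simp add: power2_eq_square algebra_simps)
    then have "\<bar>z\<bar> \<le> (z\<^sup>2 + s * s) / (2 * s)" using s(1) by (simp add: pos_le_divide_eq mult.commute)
    then show ?thesis using s(1) by (simp add: add_divide_distrib)
  qed
  then have "expect (replicate_pmf n p) (\<lambda>xs. \<bar>?Z xs\<bar>) \<le> expect (replicate_pmf n p) (\<lambda>xs. (?Z xs)\<^sup>2 / (2 * s) + s / 2)"
    by (intro expect_mono finite_set_replicate_pmf fin)
  also have "\<dots> = expect (replicate_pmf n p) (\<lambda>xs. (?Z xs)\<^sup>2) / (2 * s) + s / 2"
    by (simp add: expect_add[OF finite_set_replicate_pmf[OF fin]])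
  also have "\<dots> \<le> real n / (2 * s) + s / 2"
    using expect_count_deviation(2)[OF fin, of n a] s(1) by (intro add_right_mono divide_right_mono) auto
  also have "\<dots> = s" using s by (simp add: field_simps)
  finally show ?thesis by (simp add: s_def)
qed simp

section \<open>Measures invariant under permutation of positions\<close>

lemma map_pmf_self:
  assumes inj: "inj_on h (set_pmf q)" and onto: "h ` set_pmf q = set_pmf q"
    and inv: "\<And>x. x \<in> set_pmf q \<Longrightarrow> pmf q (h x) = pmf q x"
  shows "map_pmf h q = q"
proof (rule pmf_eqI)
  fix y
  show "pmf (map_pmf h q) y = pmf q y"
  proof (cases "y \<in> set_pmf q")
    case True
    then obtain x where "x \<in> set_pmf q" "y = h x" using onto by blast
    then show ?thesis using pmf_map_inj[OF inj] inv by simp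
  next
    case False
    then have "y \<notin> set_pmf (map_pmf h q)" using onto by simp
    then show ?thesis using False unfolding set_pmf_iff by simp
  qed
qed

lemma permute_list_inv:
  assumes "\<sigma> permutes {..<length xs}"
  shows "permute_list (Hilbert_Choice.inv \<sigma>) (permute_list \<sigma> xs) = xs"
    "permute_list \<sigma> (permute_list (Hilbert_Choice.inv \<sigma>) xs) = xs"
  using permute_list_compose[of "Hilbert_Choice.inv \<sigma>" xs \<sigma>] permute_list_compose[of \<sigma> xs "Hilbert_Choice.inv \<sigma>"] assms
  by (simp_all add: permutes_inv permutes_inv_o)

lemma inj_on_permute_list:
  assumes "\<sigma> permutes {..<n}"
  shows "inj_on (permute_list \<sigma>) {xs. length xs = n}"
  using permute_list_inv(1) assms by (intro inj_on_inverseI[where g = "permute_list (Hilbert_Choice.inv \<sigma>)"]) auto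

text \<open>Invariance is asked of all permutations because surjectivity on the atoms uses the
  inverse of \<sigma>.\<close>

lemma map_permute_list_self:
  assumes \<sigma>: "\<sigma> permutes {..<n}" and len: "\<And>xs. xs \<in> set_pmf q \<Longrightarrow> length xs = n"
    and inv: "\<And>\<tau> xs. \<tau> permutes {..<n} \<Longrightarrow> length xs = n \<Longrightarrow> pmf q (permute_list \<tau> xs) = pmf q xs"
  shows "map_pmf (permute_list \<sigma>) q = q"
proof (rule map_pmf_self)
  show "inj_on (permute_list \<sigma>) (set_pmf q)"
    using inj_on_permute_list[OF \<sigma>] by (rule inj_on_subset) (auto simp: len)
  have mem: "permute_list \<tau> xs \<in> set_pmf q" if "\<tau> permutes {..<n}" "xs \<in> set_pmf q" for \<tau> xs
    using inv[OF that(1) len[OF that(2)]] that(2) by (simp add: set_pmf_iff)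
  show "permute_list \<sigma> ` set_pmf q = set_pmf q"
  proof
    show "set_pmf q \<subseteq> permute_list \<sigma> ` set_pmf q"
    proof
      fix xs assume xs: "xs \<in> set_pmf q"
      then have "xs = permute_list \<sigma> (permute_list (Hilbert_Choice.inv \<sigma>) xs)"
        using permute_list_inv(2) \<sigma> len by metis
      moreover have "permute_list (Hilbert_Choice.inv \<sigma>) xs \<in> set_pmf q"
        by (rule mem[OF permutes_inv[OF \<sigma>] xs])
      ultimately show "xs \<in> permute_list \<sigma> ` set_pmf q" by (rule image_eqI)
    qed
  qed (use mem[OF \<sigma>] in auto)
  show "pmf q (permute_list \<sigma> xs) = pmf q xs" if "xs \<in> set_pmf q" for xs
    by (rule inv[OF \<sigma> len[OF that]])
qed

text \<open>Exchangeability: the weight depends on the sequence only through its multiset of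
  letters.\<close>

lemma pmf_replicate_pmf:
  "length xs = n \<Longrightarrow> pmf (replicate_pmf n p) xs = prod_mset (image_mset (pmf p) (mset xs))"
proof (induction n arbitrary: xs)
  case (Suc n)
  then obtain y ys where xs: "xs = y # ys" "length ys = n" by (auto simp: length_Suc_conv)
  have "inj (\<lambda>(x, xs). x # xs)" by (auto simp: inj_on_def)
  from pmf_map_inj'[OF this, of "pair_pmf p (replicate_pmf n p)" "(y, ys)"] show ?case
    by (simp add: replicate_pmf_Suc xs pmf_pair Suc.IH del: replicate_pmf.simps)
qed simp

lemma map_permute_list_replicate_pmf:
  assumes "\<sigma> permutes {..<n}"
  shows "map_pmf (permute_list \<sigma>) (replicate_pmf n p) = replicate_pmf n p"
  using assms by (intro map_permute_list_self) (auto simp: set_replicate_pmf pmf_replicate_pmf)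

lemma map_permute_list_permutations_of_multiset:
  assumes "\<sigma> permutes {..<size M}"
  shows "map_pmf (permute_list \<sigma>) (pmf_of_set (permutations_of_multiset M)) = pmf_of_set (permutations_of_multiset M)"
proof (rule map_permute_list_self[OF assms])
  fix xs assume "xs \<in> set_pmf (pmf_of_set (permutations_of_multiset M))"
  then have "mset xs = M" by (simp add: permutations_of_multisetD)
  then show "length xs = size M" by auto
next
  fix \<tau> and xs :: "'a list" assume "\<tau> permutes {..<size M}" "length xs = size M"
  then have "permute_list \<tau> xs \<in> permutations_of_multiset M \<longleftrightarrow> xs \<in> permutations_of_multiset M"
    by (simp add: permutations_of_multiset_def)
  then show "pmf (pmf_of_set (permutations_of_multiset M)) (permute_list \<tau> xs)
      = pmf (pmf_of_set (permutations_of_multiset M)) xs"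
    by (simp add: indicator_def)
qed

text \<open>Composition with a fixed permutation preserves the uniform law on permutations, so the
  law of the rearranged \<open>ys\<close> is invariant. The permutations act transitively on the
  rearrangements, hence all weights are equal.\<close>

lemma random_permutation_uniform:
  assumes len: "length ys = n"
  shows "map_pmf (\<lambda>\<sigma>. permute_list \<sigma> ys) (pmf_of_set {\<sigma>. \<sigma> permutes {..<n}})
      = pmf_of_set (permutations_of_multiset (mset ys))" (is "?q = pmf_of_set ?T")
proof -
  let ?P = "{\<sigma>. \<sigma> permutes {..<n}}"
  have finP: "finite ?P" "?P \<noteq> {}" using finite_permutations[of "{..<n}"] permutes_id[of "{..<n}"] by blast+
  have set_q: "set_pmf ?q = (\<lambda>\<sigma>. permute_list \<sigma> ys) ` ?P" using finP by simp
  have T: "?T = (\<lambda>\<sigma>. permute_list \<sigma> ys) ` ?P"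
  proof
    show "?T \<subseteq> (\<lambda>\<sigma>. permute_list \<sigma> ys) ` ?P"
    proof
      fix zs assume "zs \<in> ?T"
      then have "mset zs = mset ys" by (simp add: permutations_of_multiset_def)
      then obtain \<tau> where "\<tau> permutes {..<length ys}" "permute_list \<tau> ys = zs"
        by (rule mset_eq_permutation)
      then show "zs \<in> (\<lambda>\<sigma>. permute_list \<sigma> ys) ` ?P" using len by blast
    qed
  qed (use len in \<open>auto simp: permutations_of_multiset_def\<close>)
  have inv: "map_pmf (permute_list \<tau>) ?q = ?q" if \<tau>: "\<tau> \<in> ?P" for \<tau>
  proof -
    have "map_pmf (permute_list \<tau>) ?q = map_pmf (\<lambda>\<sigma>. permute_list (\<sigma> \<circ> \<tau>) ys) (pmf_of_set ?P)"
      using \<tau> len by (simp add: pmf.map_comp o_def permute_list_compose[unfolded o_def])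
    also have "\<dots> = map_pmf (\<lambda>\<sigma>. permute_list \<sigma> ys) (map_pmf (\<lambda>\<sigma>. \<sigma> \<circ> \<tau>) (pmf_of_set ?P))"
      by (simp add: pmf.map_comp o_def)
    also have "map_pmf (\<lambda>\<sigma>. \<sigma> \<circ> \<tau>) (pmf_of_set ?P) = pmf_of_set ?P"
    proof (rule map_pmf_of_set_bij_betw)
      show "bij_betw (\<lambda>\<sigma>. \<sigma> \<circ> \<tau>) ?P ?P"
        using \<tau> by (intro bij_betw_byWitness[where f' = "\<lambda>\<sigma>. \<sigma> \<circ> Hilbert_Choice.inv \<tau>"])
          (auto simp: o_assoc[symmetric] permutes_inv_o permutes_compose permutes_inv)
    qed (use finP in auto)
    finally show ?thesis .
  qed
  have "pmf ?q zs = pmf ?q ys" if zs: "zs \<in> ?T" for zs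
  proof -
    obtain \<tau> where \<tau>: "\<tau> \<in> ?P" "zs = permute_list \<tau> ys" using zs T by blast
    have "ys \<in> set_pmf ?q" unfolding set_q using permutes_id[of "{..<n}"] by (intro image_eqI[of _ _ id]) auto
    moreover have "inj_on (permute_list \<tau>) (set_pmf ?q)"
      using \<tau>(1) inj_on_permute_list[of \<tau> n] unfolding set_q by (rule_tac inj_on_subset) (auto simp: len)
    ultimately have "pmf (map_pmf (permute_list \<tau>) ?q) (permute_list \<tau> ys) = pmf ?q ys"
      by (intro pmf_map_inj)
    then show ?thesis unfolding inv[OF \<tau>(1)] \<tau>(2) .
  qed
  then have c: "pmf ?q zs = (if zs \<in> ?T then pmf ?q ys else 0)" for zs
    using set_q T by (auto simp: pmf_eq_0_set_pmf)
  have finT: "finite ?T" "?T \<noteq> {}" by auto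
  have "1 = (\<Sum>zs\<in>?T. pmf ?q zs)" using sum_pmf_eq_1[OF finT(1), of ?q] set_q T by simp
  also have "\<dots> = real (card ?T) * pmf ?q ys" by (simp add: c)
  finally have "pmf ?q ys = 1 / real (card ?T)" using finT by (simp add: field_simps)
  then show ?thesis
    using c finT by (intro pmf_eqI) (simp add: pmf_of_set indicator_def)
qed

text \<open>Likelihood of \<open>v\<close> given \<open>u\<close> under a memoryless channel. Used as the reference kernel in
  Gibbs' inequality it yields a Fano-type bound that is linear in the Hamming distance.\<close>

definition channel :: "real \<Rightarrow> real \<Rightarrow> 'a list \<Rightarrow> 'a list \<Rightarrow> real" where
  "channel t K u v = prod_list (map2 (\<lambda>a b. if a = b then 1 - t else t / K) u v)"

text \<open>Letters contribute independently, and each row has mass at most (1 - t) + |A| t / K. As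
  a sub-probability kernel is enough for Gibbs' inequality, \<open>K\<close> may be any upper bound
  for the alphabet size, so one value can serve all objects.\<close>

lemma channel_sum_le_1:
  assumes A: "finite A" "real (card A) \<le> K" and t: "0 < t" "t < 1" and K: "1 \<le> K"
  shows "(\<Sum>v\<in>{v. set v \<subseteq> A \<and> length v = length u}. channel t K u v) \<le> 1"
proof (induction u)
  case Nil
  have "{v. set v \<subseteq> A \<and> v = []} = {[]}" by auto
  then show ?case by (simp add: channel_def)
next
  case (Cons a u)
  let ?L = "{v. set v \<subseteq> A \<and> length v = length u}"
  have nonneg: "0 \<le> channel t K u v" for v
    unfolding channel_def using t K by (intro prod_list_nonneg) auto
  have "(\<Sum>v\<in>{v. set v \<subseteq> A \<and> length v = length (a # u)}. channel t K (a # u) v)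
      = (\<Sum>(v, b)\<in>?L \<times> A. channel t K (a # u) (b # v))"
    unfolding length_Cons lists_length_Suc_eq
    by (subst sum.reindex) (auto simp: inj_on_def case_prod_beta')
  also have "\<dots> = (\<Sum>b\<in>A. if a = b then 1 - t else t / K) * (\<Sum>v\<in>?L. channel t K u v)"
    by (simp add: channel_def sum_product sum.cartesian_product[symmetric] sum.swap[of _ A])
  also have "\<dots> \<le> 1 * 1"
  proof (rule mult_mono)
    have "(\<Sum>b\<in>A. if a = b then 1 - t else t / K) \<le> (\<Sum>b\<in>A. (if a = b then 1 - t else 0) + t / K)"
      using t K by (intro sum_mono) auto
    also have "\<dots> \<le> (1 - t) + real (card A) * (t / K)"
      using t A by (simp add: sum.distrib)
    also have "\<dots> \<le> (1 - t) + K * (t / K)"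
      using A t K by (intro add_left_mono mult_right_mono) auto
    finally show "(\<Sum>b\<in>A. if a = b then 1 - t else t / K) \<le> 1" using K by simp
  qed (use Cons in \<open>auto intro!: sum_nonneg nonneg\<close>)
  finally show ?case by simp
qed

lemma channel_pos:
  assumes "0 < t" "t < 1" "1 \<le> K"
  shows "0 < channel t K u v"
proof (induction u arbitrary: v)
  case (Cons a u)
  then show ?case using assms by (cases v) (auto simp: channel_def)
qed (simp add: channel_def)

lemma minus_ln_channel_le:
  assumes "0 < t" "t < 1" "1 \<le> K" "length u = length v"
  shows "- ln (channel t K u v) \<le> real (length u) * - ln (1 - t) + ln (K / t) * real (hamming u v)"
  using assms(4)
proof (induction u v rule: list_induct2)
  case (Cons a u b v)
  have pos: "0 < channel t K u v" by (rule channel_pos[OF assms(1-3)])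
  have 1: "ln (1 - t) \<le> 0" using assms by (simp add: ln_le_zero_iff)
  have "channel t K (a # u) (b # v) = (if a = b then 1 - t else t / K) * channel t K u v"
    by (simp add: channel_def)
  then have "- ln (channel t K (a # u) (b # v)) = - ln (if a = b then 1 - t else t / K) - ln (channel t K u v)"
    using pos assms by (simp add: ln_mult)
  also have "- ln (if a = b then 1 - t else t / K) \<le> - ln (1 - t) + (if a = b then 0 else ln (K / t))"
    using 1 assms by (simp add: ln_div)
  finally show ?case using Cons.IH by (cases "a = b") (simp_all add: algebra_simps)
qed (simp add: channel_def)

text \<open>The parameter \<open>t\<close> is left free: a small \<open>t\<close> makes the first
  term a small multiple of \<open>n\<close>, and for that fixed \<open>t\<close> the second term is
  sublinear as soon as the mean Hamming distance is.\<close>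

lemma ent_lists_hamming_le:
  assumes fin: "finite (set_pmf p)" and A: "finite A" "real (card A) \<le> K"
    and t: "0 < t" "t < 1" and K: "1 \<le> K"
    and UV: "\<And>x. x \<in> set_pmf p \<Longrightarrow> length (U x) = n \<and> length (V x) = n \<and> set (V x) \<subseteq> A"
  shows "ent p (\<lambda>x. (U x, V x)) - ent p U
    \<le> real n * - ln (1 - t) + ln (K / t) * expect p (\<lambda>x. real (hamming (U x) (V x)))"
proof -
  have pos: "0 < channel t K u v" for u v :: "'b list" by (rule channel_pos[OF t K])
  have "ent p (\<lambda>x. (U x, V x)) - ent p U \<le> expect p (\<lambda>x. - ln (channel t K (U x) (V x)))"
  proof (rule ent_gibbs[OF fin])
    fix u assume "u \<in> U ` set_pmf p"
    then have "length u = n" using UV by auto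
    then have "(\<Sum>v\<in>V ` set_pmf p. channel t K u v) \<le> (\<Sum>v\<in>{v. set v \<subseteq> A \<and> length v = length u}. channel t K u v)"
      using UV finite_lists_length_eq[OF A(1)] less_imp_le[OF pos] by (intro sum_mono2) auto
    also have "\<dots> \<le> 1" by (rule channel_sum_le_1[OF A t K])
    finally show "(\<Sum>v\<in>V ` set_pmf p. channel t K u v) \<le> 1" .
  qed (use pos in \<open>auto intro: less_imp_le\<close>)
  also have "\<dots> \<le> expect p (\<lambda>x. real n * - ln (1 - t) + ln (K / t) * real (hamming (U x) (V x)))"
  proof (rule expect_mono[OF fin])
    fix x assume "x \<in> set_pmf p"
    then show "- ln (channel t K (U x) (V x)) \<le> real n * - ln (1 - t) + ln (K / t) * real (hamming (U x) (V x))"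
      using minus_ln_channel_le[OF t K, of "U x" "V x"] UV by auto
  qed
  also have "\<dots> = real n * - ln (1 - t) + ln (K / t) * expect p (\<lambda>x. real (hamming (U x) (V x)))"
    by (simp add: expect_diff[OF fin])
  finally show ?thesis .
qed

text \<open>The nesting that \<open>tensor_power\<close> produces, with the point 0 of
  \<open>neutral\<close> innermost. It is injective only among lists of equal length:
  \<open>[]\<close> and \<open>[0]\<close> have the same code.\<close>

primrec tuple_encode :: "nat list \<Rightarrow> nat" where
  "tuple_encode [] = 0"
| "tuple_encode (x # xs) = prod_encode (x, tuple_encode xs)"

lemma tuple_encode_eq_iff: "length xs = length ys \<Longrightarrow> tuple_encode xs = tuple_encode ys \<longleftrightarrow> xs = ys"
  by (induction xs ys rule: list_induct2) (auto simp: prod_encode_eq)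

lemma pspace_tensor_power: "pspace (tensor_power X n) i = map_pmf tuple_encode (replicate_pmf n (pspace X i))"
proof (induction n)
  case (Suc n)
  have "pspace (tensor_power X (Suc n)) i
      = map_pmf prod_encode (pair_pmf (pspace X i) (map_pmf tuple_encode (replicate_pmf n (pspace X i))))"
    by (simp add: tensor_def Suc)
  also have "\<dots> = map_pmf tuple_encode (replicate_pmf (Suc n) (pspace X i))"
    by (simp add: replicate_pmf_Suc pair_map_pmf2 pmf.map_comp o_def case_prod_beta' apsnd_def map_prod_def del: replicate_pmf.simps)
  finally show ?case .
qed (simp add: neutral_def)

lemma red_tensor_power:
  "length xs = n \<Longrightarrow> red (tensor_power X n) i j (tuple_encode xs) = tuple_encode (map (red X i j) xs)"
proof (induction n arbitrary: xs)
  case (Suc n)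
  then show ?case by (auto simp: length_Suc_conv tensor_def)
qed (simp add: neutral_def)

text \<open>The excess is estimated letter by letter through common reference counts
  \<open>c\<close>, later the expected ones.\<close>

lemma size_diff_mset_le:
  assumes "finite S" "set xs \<subseteq> S"
  shows "real (size (mset xs - M)) \<le> (\<Sum>a\<in>S. \<bar>real (count (mset xs) a) - c a\<bar>) + (\<Sum>a\<in>S. \<bar>real (count M a) - c a\<bar>)"
proof -
  have "size (mset xs - M) = (\<Sum>a\<in>set_mset (mset xs - M). count (mset xs - M) a)"
    by (simp add: size_multiset_overloaded_eq)
  also have "\<dots> \<le> (\<Sum>a\<in>S. count (mset xs - M) a)"
    using assms in_diffD[of _ "mset xs" M] by (intro sum_mono2) fastforce+
  finally have "real (size (mset xs - M)) \<le> (\<Sum>a\<in>S. real (count (mset xs - M) a))"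
    by (metis of_nat_le_iff of_nat_sum)
  also have "\<dots> \<le> (\<Sum>a\<in>S. \<bar>real (count (mset xs) a) - c a\<bar> + \<bar>real (count M a) - c a\<bar>)"
    by (intro sum_mono) (auto simp: of_nat_diff_if)
  finally show ?thesis by (simp add: sum.distrib)
qed

text \<open>Draw a sequence \<open>xs\<close> of independent letters and, independently, a uniform
  permutation. Permuting \<open>xs\<close> does not alter its law, while permuting a close
  rearrangement \<open>F xs\<close> of a fixed \<open>y\<close> makes it uniform on the type class,
  whatever \<open>F xs\<close> was. Both are permuted alike, so their Hamming distance is
  unchanged.\<close>

lemma typical_sequence_coupling:
  assumes fin: "finite (set_pmf p)"
  obtains M :: "'a multiset" and w and f g where
    "size M = n" "set_mset M \<subseteq> set_pmf p" "finite (set_pmf w)"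
    "map_pmf f w = replicate_pmf n p" "map_pmf g w = pmf_of_set (permutations_of_multiset M)"
    "expect (w :: ((nat \<Rightarrow> nat) \<times> 'a list) pmf) (\<lambda>z. real (hamming (f z) (g z))) \<le> 2 * real (card (set_pmf p)) * sqrt (real n)"
proof -
  let ?S = "set_pmf p" and ?R = "replicate_pmf n p" and ?P = "{\<sigma>. \<sigma> permutes {..<n}}"
  let ?b = "real (card ?S) * sqrt (real n)"
  define V where "V xs = (\<Sum>a\<in>?S. \<bar>real (count (mset xs) a) - real n * pmf p a\<bar>)" for xs
  have finR: "finite (set_pmf ?R)" by (rule finite_set_replicate_pmf[OF fin])
  have "expect ?R V = (\<Sum>a\<in>?S. expect ?R (\<lambda>xs. \<bar>real (count (mset xs) a) - real n * pmf p a\<bar>))"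
    unfolding V_def by (intro Bochner_Integration.integral_sum integrable_measure_pmf_finite finR)
  also have "\<dots> \<le> (\<Sum>a\<in>?S. sqrt (real n))"
    by (intro sum_mono expect_abs_count_deviation_le fin)
  finally have EV: "expect ?R V \<le> ?b" by simp
  \<comment> \<open>The least deviation is at most the mean one. Since \<open>y\<close> is an actual
    sequence, its letter counts are integers of total \<open>n\<close>, and the expected counts
    never have to be rounded.\<close>
  have "\<exists>y\<in>set_pmf ?R. \<forall>x\<in>set_pmf ?R. V y \<le> V x"
    using ex_is_arg_min_if_finite[OF finR set_pmf_not_empty, of V] by (auto simp: is_arg_min_linorder)
  then obtain y where y: "y \<in> set_pmf ?R" "\<And>x. x \<in> set_pmf ?R \<Longrightarrow> V y \<le> V x" by auto
  have "expect ?R (\<lambda>x. V y) \<le> expect ?R V" by (rule expect_mono[OF finR y(2)])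
  then have Vy: "V y \<le> ?b" using EV by simp
  have ly: "length y = n" "set y \<subseteq> ?S" using y(1) by (auto simp: set_replicate_pmf)
  define F where "F xs = (SOME ys. mset ys = mset y \<and> hamming xs ys \<le> size (mset xs - mset y))" for xs :: "'a list"
  have F: "mset (F xs) = mset y" "hamming xs (F xs) \<le> size (mset xs - mset y)" if "length xs = n" for xs
    using someI_ex[OF rearrangement_hamming_le[of xs "mset y"]] that ly(1) unfolding F_def by auto
  have lF: "length (F xs) = n" if "length xs = n" for xs using F(1)[OF that] ly(1) by (metis size_mset)
  have lR: "length xs = n" "set xs \<subseteq> ?S" if "xs \<in> set_pmf ?R" for xs using that by (auto simp: set_replicate_pmf)
  have finP: "finite ?P" "?P \<noteq> {}" using finite_permutations[of "{..<n}"] permutes_id[of "{..<n}"] by blast+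
  define w where "w = pair_pmf (pmf_of_set ?P) ?R"
  have finw: "finite (set_pmf w)" using finP finR by (simp add: w_def)
  have wz: "fst z permutes {..<n}" "snd z \<in> set_pmf ?R" if "z \<in> set_pmf w" for z
    using that finP by (auto simp: w_def)
  let ?f = "\<lambda>z. permute_list (fst z) (snd z)" and ?g = "\<lambda>z. permute_list (fst z) (F (snd z))"
  have "map_pmf ?f w = pmf_of_set ?P \<bind> (\<lambda>\<sigma>. map_pmf (permute_list \<sigma>) ?R)"
    by (simp add: w_def pair_pmf_def map_bind_pmf map_pmf_def bind_assoc_pmf bind_return_pmf)
  also have "\<dots> = pmf_of_set ?P \<bind> (\<lambda>\<sigma>. ?R)"
    using finP by (intro bind_pmf_cong refl map_permute_list_replicate_pmf) simp
  finally have f: "map_pmf ?f w = ?R" by simp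
  have "map_pmf ?g w = ?R \<bind> (\<lambda>xs. map_pmf (\<lambda>\<sigma>. permute_list \<sigma> (F xs)) (pmf_of_set ?P))"
    by (simp add: w_def pair_pmf_def map_bind_pmf map_pmf_def bind_assoc_pmf bind_return_pmf bind_commute_pmf[of ?R])
  also have "\<dots> = ?R \<bind> (\<lambda>xs. pmf_of_set (permutations_of_multiset (mset y)))"
  proof (intro bind_pmf_cong refl)
    fix xs assume "xs \<in> set_pmf ?R"
    then show "map_pmf (\<lambda>\<sigma>. permute_list \<sigma> (F xs)) (pmf_of_set ?P) = pmf_of_set (permutations_of_multiset (mset y))"
      using random_permutation_uniform[OF lF[of xs]] F(1)[of xs] lR by simp
  qed
  finally have g: "map_pmf ?g w = pmf_of_set (permutations_of_multiset (mset y))" by simp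
  have "expect w (\<lambda>z. real (hamming (?f z) (?g z))) = expect w (\<lambda>z. real (hamming (snd z) (F (snd z))))"
    using wz lR lF by (intro expect_cong) (simp add: hamming_permute_list)
  also have "\<dots> = expect (map_pmf snd w) (\<lambda>xs. real (hamming xs (F xs)))" by simp
  also have "\<dots> = expect ?R (\<lambda>xs. real (hamming xs (F xs)))" by (simp add: w_def map_snd_pair_pmf)
  also have "\<dots> \<le> expect ?R (\<lambda>xs. V xs + V y)"
  proof (rule expect_mono[OF finR])
    fix xs assume "xs \<in> set_pmf ?R"
    note xs = lR[OF this]
    have "real (hamming xs (F xs)) \<le> real (size (mset xs - mset y))" using F(2)[OF xs(1)] by simp
    also have "\<dots> \<le> V xs + V y" unfolding V_def by (rule size_diff_mset_le[OF fin xs(2)])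
    finally show "real (hamming xs (F xs)) \<le> V xs + V y" .
  qed
  also have "\<dots> \<le> 2 * real (card ?S) * sqrt (real n)"
    using EV Vy by (simp add: expect_add[OF finR])
  finally show thesis using ly by (intro that[OF _ _ finw f g]) auto
qed

section \<open>The homogeneous diagram of a type class\<close>

context initial_index
begin

text \<open>All spaces are images of the uniform law on the arrangements of \<open>M\<close>. Here
  \<open>list_encode\<close> is used because the reductions have to decode a point into its list of
  letters.\<close>

definition type_class_diagram :: "'o diagram \<Rightarrow> nat multiset \<Rightarrow> 'o diagram" where
  "type_class_diagram X M =
    \<lparr>pspace = (\<lambda>i. map_pmf (\<lambda>ys. list_encode (map (red X ini i) ys)) (pmf_of_set (permutations_of_multiset M))),
     red = (\<lambda>i j z. list_encode (map (red X i j) (list_decode z)))\<rparr>"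

lemma red_type_class: "red (type_class_diagram X M) i j (list_encode ys) = list_encode (map (red X i j) ys)"
  by (simp add: type_class_diagram_def)

lemma pspace_type_class: "pspace (type_class_diagram X M) i
    = map_pmf (\<lambda>ys. list_encode (map (red X ini i) ys)) (pmf_of_set (permutations_of_multiset M))"
  by (simp add: type_class_diagram_def)

text \<open>A permutation of positions commutes with coordinatewise maps, hence acts on all spaces
  compatibly with the reductions, and its inverse acts as the inverse. Any two arrangements of
  \<open>M\<close> are related by such a permutation, and so are their images at each
  object.\<close>

lemma type_class_in_Prob_h:
  assumes X: "X \<in> Prob G r" and M: "set_mset M \<subseteq> set_pmf (pspace X ini)"
  shows "type_class_diagram X M \<in> Prob_h G r"
proof -
  let ?T = "permutations_of_multiset M" and ?H = "type_class_diagram X M" and ?n = "size M"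
  have set_T: "set_pmf (pmf_of_set ?T) = ?T" by simp
  have T: "mset ys = M" "length ys = ?n" "set ys \<subseteq> set_pmf (pspace X ini)" if "ys \<in> ?T" for ys
    using permutations_of_multisetD[OF that] M by auto
  have red: "red ?H i j (list_encode (map (red X ini i) ys)) = list_encode (map (red X ini j) ys)"
    if "(i, j) \<in> r" "ys \<in> ?T" for i j ys
    using red_red[OF X that(1)] T(3)[OF that(2)] by (auto simp: red_type_class list_encode_eq)
  have H: "?H \<in> Prob G r"
    by (rule ProbI[of "pmf_of_set ?T" _ "\<lambda>i ys. list_encode (map (red X ini i) ys)"])
       (auto simp: pspace_type_class red)
  define a where "a \<sigma> i z = list_encode (permute_list \<sigma> (list_decode z))" for \<sigma> and i :: 'o and z
  have mor: "diagram_morphism G r ?H ?H (a \<sigma>)" if \<sigma>: "\<sigma> permutes {..<?n}" for \<sigma>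
  proof (rule diagram_morphismI[OF H, of ?H "\<lambda>i ys. list_encode (map (red X ini i) ys)" "pmf_of_set ?T"
        "\<lambda>ys. list_encode (map (red X ini ini) (permute_list \<sigma> ys))"])
    have "map_pmf (\<lambda>ys. list_encode (map (red X ini ini) (permute_list \<sigma> ys))) (pmf_of_set ?T)
        = map_pmf (\<lambda>ys. list_encode (map (red X ini ini) ys)) (map_pmf (permute_list \<sigma>) (pmf_of_set ?T))"
      by (simp add: pmf.map_comp o_def)
    then show "map_pmf (\<lambda>ys. list_encode (map (red X ini ini) (permute_list \<sigma> ys))) (pmf_of_set ?T) = pspace ?H ini"
      by (simp only: map_permute_list_permutations_of_multiset[OF \<sigma>] pspace_type_class)
  next
    fix i ys assume i: "i \<in> G" and "ys \<in> set_pmf (pmf_of_set ?T)"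
    then have ys: "ys \<in> ?T" by simp
    then have ys': "permute_list \<sigma> ys \<in> ?T"
      using \<sigma> T[OF ys] by (simp add: permutations_of_multiset_def)
    have "a \<sigma> i (list_encode (map (red X ini i) ys)) = list_encode (map (red X ini i) (permute_list \<sigma> ys))"
      using \<sigma> T(2)[OF ys] by (simp add: a_def permute_list_map)
    then show "a \<sigma> i (list_encode (map (red X ini i) ys))
        = red ?H ini i (list_encode (map (red X ini ini) (permute_list \<sigma> ys)))"
      by (simp only: red[OF ini_le[OF i] ys'])
  qed (auto simp: pspace_type_class red)
  have iso: "diagram_isomorphism G r ?H ?H (a \<sigma>)" if \<sigma>: "\<sigma> permutes {..<?n}" for \<sigma>
    unfolding diagram_isomorphism_def
    using mor[OF \<sigma>] mor[OF permutes_inv[OF \<sigma>]] T(2) \<sigma>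
    by (intro conjI exI[of _ "a (Hilbert_Choice.inv \<sigma>)"])
       (auto simp: a_def pspace_type_class permute_list_inv)
  have "homogeneous G r ?H"
    unfolding homogeneous_def
  proof (intro ballI)
    fix i x y assume "i \<in> G" "x \<in> set_pmf (pspace ?H i)" "y \<in> set_pmf (pspace ?H i)"
    then obtain xs ys where xs: "xs \<in> ?T" "x = list_encode (map (red X ini i) xs)"
      and ys: "ys \<in> ?T" "y = list_encode (map (red X ini i) ys)" by (auto simp: pspace_type_class)
    have "mset ys = mset xs" using T(1)[OF xs(1)] T(1)[OF ys(1)] by simp
    then obtain \<sigma> where \<sigma>: "\<sigma> permutes {..<length xs}" "permute_list \<sigma> xs = ys"
      by (rule mset_eq_permutation)
    then have "a \<sigma> i x = y" by (simp add: a_def xs(2) ys(2) permute_list_map flip: \<sigma>(2))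
    then show "\<exists>f. diagram_isomorphism G r ?H ?H f \<and> f i x = y"
      using iso \<sigma>(1) T(2)[OF xs(1)] by auto
  qed
  then show ?thesis using H by (simp add: Prob_h_def)
qed

text \<open>One coupling over the initial object serves all objects: reductions applied letter by
  letter do not increase Hamming distance, and no alphabet has more than \<open>K\<close> letters.
  The factor 2 counts the two conditional entropies at each object.\<close>

lemma type_class_approximation:
  assumes X: "X \<in> Prob G r" and t: "0 < t" "t < 1"
  defines "K \<equiv> real (card (set_pmf (pspace X ini)))"
  shows "\<exists>H\<in>Prob_h G r. intrinsic_dist G r (tensor_power X n) H
    \<le> real (card G) * (2 * (real n * - ln (1 - t) + ln (K / t) * (2 * K * sqrt (real n))))"
proof -
  let ?p = "pspace X ini" and ?S = "set_pmf (pspace X ini)"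
  have finS: "finite ?S" by (rule finite_pspace[OF X ini])
  have "0 < card ?S" using finS by (simp add: card_gt_0_iff set_pmf_not_empty)
  then have K: "1 \<le> K" unfolding K_def by linarith
  obtain M :: "nat multiset" and w :: "((nat \<Rightarrow> nat) \<times> nat list) pmf" and f g where
    M: "size M = n" "set_mset M \<subseteq> ?S" and fin: "finite (set_pmf w)"
    and f: "map_pmf f w = replicate_pmf n ?p" and g: "map_pmf g w = pmf_of_set (permutations_of_multiset M)"
    and d: "expect w (\<lambda>z. real (hamming (f z) (g z))) \<le> 2 * K * sqrt (real n)"
    unfolding K_def by (rule typical_sequence_coupling[OF finS, of n])
  let ?H = "type_class_diagram X M"
  have H: "?H \<in> Prob_h G r" by (rule type_class_in_Prob_h[OF X M(2)])
  then have HP: "?H \<in> Prob G r" by (simp add: Prob_h_def)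
  have fz: "length (f z) = n" "set (f z) \<subseteq> ?S" if "z \<in> set_pmf w" for z
  proof -
    have "f z \<in> set_pmf (replicate_pmf n ?p)" using that by (auto simp flip: f)
    then show "length (f z) = n" "set (f z) \<subseteq> ?S" by (auto simp: set_replicate_pmf)
  qed
  have gz: "length (g z) = n" "set (g z) \<subseteq> ?S" if "z \<in> set_pmf w" for z
  proof -
    have "g z \<in> set_pmf (map_pmf g w)" using that by simp
    then have "mset (g z) = M" by (simp add: g permutations_of_multisetD)
    then show "length (g z) = n" "set (g z) \<subseteq> ?S" using M by auto
  qed
  let ?U = "\<lambda>i z. map (red X ini i) (f z)" and ?V = "\<lambda>i z. map (red X ini i) (g z)"
  have "intrinsic_dist G r (tensor_power X n) ?H
     \<le> joint_cost G w (\<lambda>i z. red (tensor_power X n) ini i (tuple_encode (f z)))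
        (\<lambda>i z. red ?H ini i (list_encode (map (red X ini ini) (g z))))"
  proof (rule intrinsic_dist_le_joint_cost[OF tensor_power_in_Prob[OF X] HP fin])
    show "map_pmf (\<lambda>z. tuple_encode (f z)) w = pspace (tensor_power X n) ini"
      unfolding pspace_tensor_power f[symmetric] by (simp add: pmf.map_comp o_def)
    show "map_pmf (\<lambda>z. list_encode (map (red X ini ini) (g z))) w = pspace ?H ini"
      unfolding pspace_type_class g[symmetric] by (simp add: pmf.map_comp o_def)
  qed
  also have "\<dots> = joint_cost G w ?U ?V"
  proof (rule joint_cost_eqI[OF fin])
    fix i x y assume i: "i \<in> G" and xy: "x \<in> set_pmf w" "y \<in> set_pmf w"
    show "red (tensor_power X n) ini i (tuple_encode (f x)) = red (tensor_power X n) ini i (tuple_encode (f y))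
        \<longleftrightarrow> ?U i x = ?U i y"
      using fz(1) xy by (simp add: red_tensor_power tuple_encode_eq_iff)
    \<comment> \<open>\<open>red X ini ini\<close> is the identity only on atoms, which is why the
      letters of \<open>g z\<close> must lie in the support.\<close>
    have "map (red X ini i) (map (red X ini ini) (g z)) = ?V i z" if "z \<in> set_pmf w" for z
      using gz(2)[OF that] red_ini[OF X] by auto
    then show "red ?H ini i (list_encode (map (red X ini ini) (g x))) = red ?H ini i (list_encode (map (red X ini ini) (g y)))
        \<longleftrightarrow> ?V i x = ?V i y"
      using xy by (simp only: red_type_class list_encode_eq)
  qed
  also have "\<dots> \<le> (\<Sum>i\<in>G. 2 * (real n * - ln (1 - t) + ln (K / t) * (2 * K * sqrt (real n))))"
    unfolding joint_cost_def
  proof (rule sum_mono)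
    fix i assume i: "i \<in> G"
    let ?A = "red X ini i ` ?S" and ?b = "real n * - ln (1 - t) + ln (K / t) * (2 * K * sqrt (real n))"
    have A: "finite ?A" "real (card ?A) \<le> K" using finS by (auto simp: K_def card_image_le)
    have h: "expect w (\<lambda>z. real (hamming (?U i z) (?V i z))) \<le> 2 * K * sqrt (real n)"
    proof -
      have "expect w (\<lambda>z. real (hamming (?U i z) (?V i z))) \<le> expect w (\<lambda>z. real (hamming (f z) (g z)))"
        using fz(1) gz(1) by (intro expect_mono fin of_nat_mono hamming_map_le) simp
      then show ?thesis using d by linarith
    qed
    have h': "expect w (\<lambda>z. real (hamming (?V i z) (?U i z))) = expect w (\<lambda>z. real (hamming (?U i z) (?V i z)))"
      using fz(1) gz(1) by (intro expect_cong) (simp add: hamming_commute)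
    have lnK: "0 \<le> ln (K / t)" using K t by (intro ln_ge_zero) (simp add: field_simps)
    have "ent w (\<lambda>z. (?U i z, ?V i z)) - ent w (?U i)
       \<le> real n * - ln (1 - t) + ln (K / t) * expect w (\<lambda>z. real (hamming (?U i z) (?V i z)))"
      using fz gz by (intro ent_lists_hamming_le[OF fin A t K]) (simp add: image_mono)
    moreover have "ent w (\<lambda>z. (?V i z, ?U i z)) - ent w (?V i)
       \<le> real n * - ln (1 - t) + ln (K / t) * expect w (\<lambda>z. real (hamming (?V i z) (?U i z)))"
      using fz gz by (intro ent_lists_hamming_le[OF fin A t K]) (simp add: image_mono)
    moreover have "ent w (\<lambda>z. (?V i z, ?U i z)) = ent w (\<lambda>z. (?U i z, ?V i z))"
      by (rule ent_eqI[OF fin]) auto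
    moreover define b where "b = ?b"
    moreover have "real n * - ln (1 - t) + ln (K / t) * expect w (\<lambda>z. real (hamming (?U i z) (?V i z))) \<le> b"
      unfolding b_def by (intro add_left_mono mult_left_mono h lnK)
    ultimately show "2 * ent w (\<lambda>z. (?U i z, ?V i z)) - ent w (?U i) - ent w (?V i) \<le> 2 * ?b"
      unfolding h' b_def[symmetric] by linarith
  qed
  finally show ?thesis using H by auto
qed

lemma homogeneous_approximation:
  assumes X: "X \<in> Prob G r" and e: "0 < \<epsilon>"
  obtains N H where "1 \<le> N" "H \<in> Prob_h G r" "intrinsic_dist G r (tensor_power X N) H \<le> \<epsilon> * real N"
proof -
  \<comment> \<open>Over \<open>card G\<close> objects with two conditional entropies each, this
    choice leaves \<epsilon>/2 per letter for the term linear in the length.\<close>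
  define \<delta> where "\<delta> = \<epsilon> / (4 * real (card G))"
  have G: "0 < card G" using finite_G ini by (auto simp: card_gt_0_iff)
  have \<delta>: "0 < \<delta>" "real (card G) * \<delta> = \<epsilon> / 4" using e G by (auto simp: \<delta>_def)
  define t where "t = 1 - exp (- \<delta>)"
  have t: "0 < t" "t < 1" "- ln (1 - t) = \<delta>" using \<delta> by (auto simp: t_def)
  define K where "K = real (card (set_pmf (pspace X ini)))"
  define c where "c = real (card G) * (2 * (ln (K / t) * (2 * K)))"
  \<comment> \<open>The length will be m^2, whose square root is m. Then the remaining term is c m,
    and this m makes it at most \<epsilon>/2 times m^2.\<close>
  define m where "m = nat \<lceil>2 * c / \<epsilon>\<rceil> + 1"
  have "2 * c / \<epsilon> \<le> real m" unfolding m_def by linarith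
  then have c: "c \<le> \<epsilon> / 2 * real m" using e by (simp add: pos_divide_le_eq mult.commute)
  obtain H where H: "H \<in> Prob_h G r" "intrinsic_dist G r (tensor_power X (m\<^sup>2)) H
    \<le> real (card G) * (2 * (real (m\<^sup>2) * - ln (1 - t) + ln (K / t) * (2 * K * sqrt (real (m\<^sup>2)))))"
    using type_class_approximation[OF X t(1,2), of "m\<^sup>2"] unfolding K_def by auto
  have "real (card G) * (2 * (real (m\<^sup>2) * - ln (1 - t) + ln (K / t) * (2 * K * sqrt (real (m\<^sup>2)))))
      = 2 * (real (card G) * \<delta>) * real (m\<^sup>2) + c * real m"
    unfolding t(3) by (simp add: c_def algebra_simps)
  also have "\<dots> \<le> 2 * (\<epsilon> / 4) * real (m\<^sup>2) + \<epsilon> / 2 * real m * real m"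
    unfolding \<delta>(2) by (intro add_left_mono mult_right_mono c) auto
  also have "\<dots> = \<epsilon> * real (m\<^sup>2)" by (simp add: power2_eq_square)
  finally show thesis using H by (intro that[of "m\<^sup>2" H]) (auto simp: m_def)
qed

end

subsection \<open>Homogeneous quasi-linear sequences\<close>

context initial_index
begin

lemma Prob_h_subset: "X \<in> Prob_h G r \<Longrightarrow> X \<in> Prob G r"
  by (simp add: Prob_h_def)

lemma diagram_morphism_tensor:
  assumes "diagram_morphism G r X X' f" "diagram_morphism G r Y Y' g"
  shows "diagram_morphism G r (tensor X Y) (tensor X' Y') (\<lambda>i z. prod_encode (map_prod (f i) (g i) (prod_decode z)))"
  unfolding diagram_morphism_def
proof (intro conjI ballI; clarify?)
  fix i assume "i \<in> G"
  then have "map_pmf (f i) (pspace X i) = pspace X' i" "map_pmf (g i) (pspace Y i) = pspace Y' i"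
    using assms by (auto simp: diagram_morphism_def reduction_def)
  then show "reduction (pspace (tensor X Y) i) (pspace (tensor X' Y') i) (\<lambda>z. prod_encode (map_prod (f i) (g i) (prod_decode z)))"
    using map_pair[of "f i" "g i" "pspace X i" "pspace Y i"]
    by (simp add: reduction_def pspace_tensor pmf.map_comp o_def map_prod_def case_prod_beta'
        flip: pmf.map_comp[of prod_encode "\<lambda>z. (f i (fst z), g i (snd z))", unfolded o_def])
next
  fix i j z assume "(i, j) \<in> r" "z \<in> set_pmf (pspace (tensor X Y) i)"
  then show "prod_encode (map_prod (f j) (g j) (prod_decode (red (tensor X Y) i j z)))
      = red (tensor X' Y') i j (prod_encode (map_prod (f i) (g i) (prod_decode z)))"
    using assms by (auto 0 4 simp: diagram_morphism_def pspace_tensor red_tensor)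
qed

lemma diagram_isomorphism_tensor:
  assumes "diagram_isomorphism G r X X' f" "diagram_isomorphism G r Y Y' g"
  shows "diagram_isomorphism G r (tensor X Y) (tensor X' Y') (\<lambda>i z. prod_encode (map_prod (f i) (g i) (prod_decode z)))"
proof -
  obtain f' g' where f': "diagram_morphism G r X' X f'" "diagram_morphism G r Y' Y g'"
    "\<And>i. i \<in> G \<Longrightarrow> (\<forall>x\<in>set_pmf (pspace X i). f' i (f i x) = x) \<and> (\<forall>y\<in>set_pmf (pspace X' i). f i (f' i y) = y)"
    "\<And>i. i \<in> G \<Longrightarrow> (\<forall>x\<in>set_pmf (pspace Y i). g' i (g i x) = x) \<and> (\<forall>y\<in>set_pmf (pspace Y' i). g i (g' i y) = y)"
    using assms by (auto simp: diagram_isomorphism_def)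
  show ?thesis
    unfolding diagram_isomorphism_def
    using assms f' diagram_morphism_tensor[OF f'(1,2)]
    by (intro conjI diagram_morphism_tensor exI[of _ "\<lambda>i z. prod_encode (map_prod (f' i) (g' i) (prod_decode z))"])
       (auto simp: diagram_isomorphism_def pspace_tensor)
qed

lemma diagram_isomorphism_refl: "diagram_isomorphism G r X X (\<lambda>i x. x)"
proof -
  have "diagram_morphism G r X X (\<lambda>i x. x)" by (auto simp: diagram_morphism_def reduction_def)
  then show ?thesis by (auto simp: diagram_isomorphism_def intro!: exI[of _ "\<lambda>i x. x"])
qed

lemma tensor_in_Prob_h:
  assumes X: "X \<in> Prob_h G r" and Y: "Y \<in> Prob_h G r"
  shows "tensor X Y \<in> Prob_h G r"
proof -
  have "homogeneous G r (tensor X Y)"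
    unfolding homogeneous_def
  proof (intro ballI)
    fix i x y assume i: "i \<in> G" and "x \<in> set_pmf (pspace (tensor X Y) i)" "y \<in> set_pmf (pspace (tensor X Y) i)"
    then obtain a b a' b' where xy: "x = prod_encode (a, b)" "y = prod_encode (a', b')"
      and ab: "a \<in> set_pmf (pspace X i)" "b \<in> set_pmf (pspace Y i)" "a' \<in> set_pmf (pspace X i)" "b' \<in> set_pmf (pspace Y i)"
      by (auto simp: pspace_tensor)
    obtain f g where "diagram_isomorphism G r X X f" "f i a = a'" "diagram_isomorphism G r Y Y g" "g i b = b'"
      using X Y i ab unfolding Prob_h_def homogeneous_def by blast
    then show "\<exists>f. diagram_isomorphism G r (tensor X Y) (tensor X Y) f \<and> f i x = y"
      by (intro exI[of _ "\<lambda>i z. prod_encode (map_prod (f i) (g i) (prod_decode z))"])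
         (auto simp: xy diagram_isomorphism_tensor)
  qed
  then show ?thesis using X Y by (simp add: Prob_h_def tensor_in_Prob)
qed

lemma neutral_in_Prob_h: "neutral \<in> Prob_h G r"
  unfolding Prob_h_def homogeneous_def
  using diagram_isomorphism_refl by (auto simp: neutral_in_Prob pspace_neutral)

lemma tensor_power_in_Prob_h: "X \<in> Prob_h G r \<Longrightarrow> tensor_power X n \<in> Prob_h G r"
  by (induction n) (auto intro: neutral_in_Prob_h tensor_in_Prob_h)

lemma one_le_powr_three_quarters: "1 \<le> n \<Longrightarrow> 1 \<le> real n powr (3 / 4)"
  by (rule ge_one_powr_ge_zero) auto

text \<open>Integer division is additive up to a carry \<open>d\<close> of 0 or 1, so the defect is
  at most the distance between the powers 1 and 0 of \<open>H\<close>. This constant is absorbed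
  because (m + n)^(3/4) is at least 1.\<close>

lemma tensor_power_div_in_QL:
  assumes H: "H \<in> Prob_h G r" and L: "1 \<le> L"
  shows "(\<lambda>n. tensor_power H (n div L)) \<in> QL G r (\<lambda>t. t powr (3 / 4)) (Prob_h G r) (kappa G r)"
proof -
  have HP: "H \<in> Prob G r" by (rule Prob_h_subset[OF H])
  have pow: "tensor_power H n \<in> Prob G r" for n by (rule tensor_power_in_Prob[OF HP])
  let ?C = "kappa G r (tensor_power H 1) (tensor_power H 0)"
  have C: "0 \<le> ?C" by (rule kappa_nonneg[OF pow pow])
  have self: "kappa G r (tensor_power H n) (tensor_power H n) = 0" for n
    by (rule kappa_equivalent[OF equivalent_refl[OF pow]])
  have "kappa G r (tensor_power H ((m + n) div L)) (tensor (tensor_power H (m div L)) (tensor_power H (n div L)))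
      \<le> ?C * real (m + n) powr (3 / 4)" if "1 \<le> m" "1 \<le> n" for m n
  proof -
    define d where "d = (m mod L + n mod L) div L"
    have d: "(m + n) div L = m div L + n div L + d" unfolding d_def by (rule div_add1_eq)
    have "m mod L + n mod L < 2 * L"
      using mod_less_divisor[of L m] mod_less_divisor[of L n] L by linarith
    then have "d < 2" unfolding d_def using L by (simp add: less_mult_imp_div_less)
    then have d01: "d = 0 \<or> d = 1" by auto
    have "kappa G r (tensor_power H ((m + n) div L)) (tensor (tensor_power H (m div L)) (tensor_power H (n div L)))
        = kappa G r (tensor_power H (m div L + n div L + d)) (tensor_power H (m div L + n div L + 0))"
      unfolding d add_0_right
      by (rule kappa_cong[OF equivalent_refl[OF pow] equivalent_sym[OF equivalent_tensor_power_add[OF HP]]])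
    also have "\<dots> \<le> kappa G r (tensor_power H (m div L + n div L)) (tensor_power H (m div L + n div L))
        + kappa G r (tensor_power H d) (tensor_power H 0)"
      by (rule kappa_tensor_power_add_le[OF HP HP])
    also have "\<dots> \<le> ?C" using d01 self[of 0] C by (auto simp: self)
    also have "\<dots> \<le> ?C * real (m + n) powr (3 / 4)"
      using mult_left_mono[OF one_le_powr_three_quarters[of "m + n"] C] that by simp
    finally show ?thesis .
  qed
  moreover have "isomorphic_diagrams G r neutral neutral"
    unfolding isomorphic_diagrams_def using diagram_isomorphism_refl by blast
  ultimately show ?thesis
    unfolding QL_def using tensor_power_in_Prob_h[OF H] C by (auto simp del: tensor_power.simps(2))
qed

text \<open>Both sides are split along the same \<open>k + l\<close>, so their distance is almost
  subadditive in \<open>n\<close>, with error constant C M^(3/4) and first term 0. The halving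
  argument then keeps the bound linear in \<open>n\<close>.\<close>

lemma kappa_power_tensor_power_le:
  assumes X: "\<And>n. X n \<in> Prob G r" and C: "0 \<le> C"
    and ql: "\<And>m n. 1 \<le> m \<Longrightarrow> 1 \<le> n \<Longrightarrow> kappa G r (X (m + n)) (tensor (X m) (X n)) \<le> C * real (m + n) powr (3 / 4)"
    and M: "1 \<le> M" and n: "1 \<le> n"
  shows "kappa G r (X (M * n)) (tensor_power (X M) n) \<le> real n * (50 * (C * real M powr (3 / 4)))"
proof -
  let ?b = "\<lambda>n. kappa G r (X (M * n)) (tensor_power (X M) n)"
  have pow: "tensor_power (X M) n \<in> Prob G r" for n by (rule tensor_power_in_Prob[OF X])
  have "?b n \<le> real n * (?b 1 + 50 * (C * real M powr (3 / 4)))"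
  proof (rule almost_subadditive_le[OF _ _ n])
    show "0 \<le> C * real M powr (3 / 4)" using C by simp
    fix k l :: nat assume kl: "1 \<le> k" "1 \<le> l"
    have "kappa G r (X (M * k + M * l)) (tensor (X (M * k)) (X (M * l))) \<le> C * real (M * k + M * l) powr (3 / 4)"
      using kl M by (intro ql) auto
    also have "real (M * k + M * l) powr (3 / 4) = real M powr (3 / 4) * real (k + l) powr (3 / 4)"
      by (subst powr_mult[symmetric]) (simp_all add: algebra_simps)
    finally have 1: "kappa G r (X (M * k + M * l)) (tensor (X (M * k)) (X (M * l)))
      \<le> C * real M powr (3 / 4) * real (k + l) powr (3 / 4)" by simp
    have 2: "kappa G r (tensor (X (M * k)) (X (M * l))) (tensor (tensor_power (X M) k) (tensor_power (X M) l))
        \<le> ?b k + ?b l"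
      by (intro kappa_tensor_le X pow)
    have "?b (k + l) = kappa G r (X (M * k + M * l)) (tensor (tensor_power (X M) k) (tensor_power (X M) l))"
      unfolding distrib_left by (intro kappa_cong equivalent_refl X equivalent_tensor_power_add)
    also have "\<dots> \<le> kappa G r (X (M * k + M * l)) (tensor (X (M * k)) (X (M * l)))
        + kappa G r (tensor (X (M * k)) (X (M * l))) (tensor (tensor_power (X M) k) (tensor_power (X M) l))"
      by (intro kappa_triangle tensor_in_Prob X pow)
    finally show "?b (k + l) \<le> ?b k + ?b l + C * real M powr (3 / 4) * real (k + l) powr (3 / 4)"
      using 1 2 by linarith
  qed
  moreover have "?b 1 = 0"
    using kappa_equivalent[OF equivalent_sym[OF equivalent_tensor_power_one[OF X]]] by simp
  ultimately show ?thesis by simp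
qed

lemma kappa_tensor_power_mult_le:
  assumes X: "X \<in> Prob G r" and H: "H \<in> Prob G r"
  shows "kappa G r (tensor_power X (N * q)) (tensor_power H q) \<le> real q * kappa G r (tensor_power X N) H"
proof (induction q)
  case 0
  show ?case using kappa_equivalent[OF equivalent_refl[OF neutral_in_Prob]] by simp
next
  case (Suc q)
  have "kappa G r (tensor_power X (N * q + N)) (tensor_power H (q + 1))
     \<le> kappa G r (tensor_power X (N * q)) (tensor_power H q) + kappa G r (tensor_power X N) (tensor_power H 1)"
    by (rule kappa_tensor_power_add_le[OF X H])
  also have "kappa G r (tensor_power X N) (tensor_power H 1) = kappa G r (tensor_power X N) H"
    by (intro kappa_cong equivalent_refl equivalent_tensor_power_one tensor_power_in_Prob X H)
  finally show ?case using Suc by (simp add: algebra_simps)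
qed

lemma homogeneous_sequence_close:
  assumes XQ: "X \<in> QL G r (\<lambda>t. t powr (3 / 4)) (Prob G r) (kappa G r)" and e: "0 < \<epsilon>"
  shows "\<exists>Y\<in>QL G r (\<lambda>t. t powr (3 / 4)) (Prob_h G r) (kappa G r). asymptotic_dist (kappa G r) X Y < \<epsilon>"
proof -
  have X: "X n \<in> Prob G r" for n using XQ by (simp add: QL_def)
  obtain C where C: "0 \<le> C"
    "\<And>m n. 1 \<le> m \<Longrightarrow> 1 \<le> n \<Longrightarrow> kappa G r (X (m + n)) (tensor (X m) (X n)) \<le> C * real (m + n) powr (3 / 4)"
    using XQ unfolding QL_def by auto
  \<comment> \<open>Replacing \<open>X (M * n)\<close> by powers of \<open>X M\<close> costs at most
    50 C M^(-1/4) per unit of length. So \<open>M\<close> is fixed first, and the homogeneous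
    \<open>H\<close> is then chosen for this block.\<close>
  have "(\<lambda>M. 50 * C * real M powr (- (1 / 4))) \<longlonglongrightarrow> 50 * C * 0"
    by (intro tendsto_intros tendsto_neg_powr filterlim_real_sequentially) auto
  then have "eventually (\<lambda>M. 50 * C * real M powr (- (1 / 4)) < \<epsilon> / 3) sequentially"
    using e by (intro order_tendstoD(2)[where a = "\<epsilon> / 3"]) auto
  then have "eventually (\<lambda>M. 50 * C * real M powr (- (1 / 4)) < \<epsilon> / 3 \<and> 1 \<le> M) sequentially"
    using eventually_ge_at_top[of 1] by (rule eventually_conj)
  then obtain M :: nat where M: "50 * C * real M powr (- (1 / 4)) < \<epsilon> / 3" "1 \<le> M"
    using eventually_happens'[OF sequentially_bot] by blast
  obtain N H where N: "1 \<le> N" and Hh: "H \<in> Prob_h G r"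
    and close: "intrinsic_dist G r (tensor_power (X M) N) H \<le> \<epsilon> / 3 * real N"
    using homogeneous_approximation[OF X[of M], of "\<epsilon> / 3"] e by auto
  have H: "H \<in> Prob G r" by (rule Prob_h_subset[OF Hh])
  have pow: "tensor_power (X M) n \<in> Prob G r" "tensor_power H n \<in> Prob G r" for n
    by (intro tensor_power_in_Prob X H)+
  have kH: "kappa G r (tensor_power (X M) N) H \<le> \<epsilon> / 3 * real N"
    using kappa_tendsto_le(2)[OF pow(1) H, of N] close by linarith
  define L where "L = M * N"
  have L: "1 \<le> L" using M N by (simp add: L_def)
  define Y where "Y = (\<lambda>n. tensor_power H (n div L))"
  have YQ: "Y \<in> QL G r (\<lambda>t. t powr (3 / 4)) (Prob_h G r) (kappa G r)"
    unfolding Y_def by (rule tensor_power_div_in_QL[OF Hh L])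
  have Y: "Y n \<in> Prob G r" for n unfolding Y_def by (rule pow)
  obtain D where D: "0 \<le> D"
    "\<And>m n. 1 \<le> m \<Longrightarrow> 1 \<le> n \<Longrightarrow> kappa G r (Y (m + n)) (tensor (Y m) (Y n)) \<le> D * real (m + n) powr (3 / 4)"
    using YQ unfolding QL_def by auto
  let ?a = "\<lambda>n. kappa G r (X n) (Y n)"
  \<comment> \<open>Both sequences are quasi-linear, so their distance is almost subadditive with
    constant C + D. This gives convergence, after which the limit can be read off along the
    multiples of \<open>L\<close>.\<close>
  have sub: "?a (m + n) \<le> ?a m + ?a n + (C + D) * real (m + n) powr (3 / 4)" if "1 \<le> m" "1 \<le> n" for m n
  proof -
    have "?a (m + n) \<le> kappa G r (X (m + n)) (tensor (X m) (X n)) + kappa G r (tensor (X m) (X n)) (Y (m + n))"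
      by (intro kappa_triangle tensor_in_Prob X Y)
    moreover have "kappa G r (tensor (X m) (X n)) (Y (m + n))
        \<le> kappa G r (tensor (X m) (X n)) (tensor (Y m) (Y n)) + kappa G r (tensor (Y m) (Y n)) (Y (m + n))"
      by (intro kappa_triangle tensor_in_Prob X Y)
    moreover have "kappa G r (tensor (X m) (X n)) (tensor (Y m) (Y n)) \<le> ?a m + ?a n"
      by (intro kappa_tensor_le X Y)
    ultimately show ?thesis
      using C(2)[OF that] D(2)[OF that] kappa_commute[of "tensor (Y m) (Y n)"] by (simp add: distrib_right)
  qed
  have lim: "(\<lambda>n. ?a n / real n) \<longlonglongrightarrow> asymptotic_dist (kappa G r) X Y"
    unfolding asymptotic_dist_def
    using almost_subadditive_tendsto[of "C + D" ?a] C(1) D(1) sub kappa_nonneg[OF X Y]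
    by (metis (no_types, lifting) add_nonneg_nonneg limI)
  have "filterlim (\<lambda>q. L * q) sequentially sequentially"
    using L by (intro filterlim_subseq) (auto simp: strict_mono_def)
  then have "(\<lambda>q. ?a (L * q) / real (L * q)) \<longlonglongrightarrow> asymptotic_dist (kappa G r) X Y"
    by (rule filterlim_compose[OF lim])
  moreover have "?a (L * q) / real (L * q) \<le> 2 * \<epsilon> / 3" if q: "1 \<le> q" for q
  proof -
    have Nq: "1 \<le> N * q" using N q by simp
    have M34: "real M powr (3 / 4) = real M * real M powr (- (1 / 4))"
      using M(2) powr_add[of "real M" 1 "- (1 / 4)"] by simp
    have "?a (L * q) = kappa G r (X (M * (N * q))) (tensor_power H q)"
      using L by (simp add: Y_def) (simp add: L_def mult.assoc)
    also have "\<dots> \<le> kappa G r (X (M * (N * q))) (tensor_power (X M) (N * q))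
        + kappa G r (tensor_power (X M) (N * q)) (tensor_power H q)"
      by (intro kappa_triangle X pow)
    also have "\<dots> \<le> real (N * q) * (50 * (C * real M powr (3 / 4))) + real q * kappa G r (tensor_power (X M) N) H"
      by (intro add_mono kappa_power_tensor_power_le kappa_tensor_power_mult_le X H C M Nq)
    also have "\<dots> \<le> real (N * q) * (50 * (C * real M powr (3 / 4))) + real q * (\<epsilon> / 3 * real N)"
      by (intro add_left_mono mult_left_mono kH) auto
    also have "\<dots> = real (L * q) * (50 * C * real M powr (- (1 / 4))) + real (N * q) * (\<epsilon> / 3)"
      unfolding M34 by (simp add: L_def algebra_simps)
    \<comment> \<open>Homogenising costs \<epsilon>/3 per copy of \<open>X M\<close>, and there are
      no more copies than units of length since N \<le> L. The total 2\<epsilon>/3 leaves room for a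
      strict inequality in the limit.\<close>
    also have "\<dots> \<le> real (L * q) * (\<epsilon> / 3) + real (L * q) * (\<epsilon> / 3)"
    proof (intro add_mono mult_left_mono mult_right_mono of_nat_mono)
      show "N \<le> L" unfolding L_def using M(2) by (cases M) auto
    qed (use M(1) e in auto)
    finally show ?thesis using L q by (simp add: divide_le_eq field_simps)
  qed
  ultimately have "asymptotic_dist (kappa G r) X Y \<le> 2 * \<epsilon> / 3"
    by (intro LIMSEQ_le_const2) blast+
  then show ?thesis using YQ e by (intro bexI[of _ Y]) auto
qed

end

text \<open>Common ancestors are taken one element at a time over finite subsets of
  \<open>G\<close>; nonemptiness of \<open>G\<close> starts the induction at the empty
  subset.\<close>

lemma initial_object_exists:
  assumes "indexing_category G r" "G \<noteq> {}"
  shows "\<exists>i\<in>G. \<forall>j\<in>G. (i, j) \<in> r"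
proof -
  have fin: "finite G" and po: "partial_order_on G r"
    and lca: "\<And>i j. i \<in> G \<Longrightarrow> j \<in> G \<Longrightarrow> \<exists>k\<in>G. (k, i) \<in> r \<and> (k, j) \<in> r"
    using assms(1) by (auto simp: indexing_category_def; blast)+
  note tr = partial_order_onD(2)[OF po]
  have "\<exists>i\<in>G. \<forall>j\<in>S. (i, j) \<in> r" if "finite S" "S \<subseteq> G" for S
    using that
  proof (induction S rule: finite_induct)
    case empty
    then show ?case using assms(2) by auto
  next
    case (insert x S)
    then obtain i where i: "i \<in> G" "\<forall>j\<in>S. (i, j) \<in> r" by auto
    obtain k where "k \<in> G" "(k, i) \<in> r" "(k, x) \<in> r" using lca[of i x] i insert by auto
    then show ?case using i transD[OF tr] by blast
  qed
  from this[OF fin] show ?thesis by simp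
qed

theorem theorem5p2:
  fixes G :: "'o set" and r :: "('o \<times> 'o) set" and \<phi> :: "real \<Rightarrow> real"
  assumes "indexing_category G r"
    and "\<phi> = (\<lambda>t. t powr (3 / 4))"
  shows "dense_wrt (asymptotic_dist (kappa G r))
           (QL G r \<phi> (Prob_h G r) (kappa G r))
           (QL G r \<phi> (Prob G r) (kappa G r))"
proof (cases "G = {}")
  case False
  then obtain ini where ini: "ini \<in> G" "\<And>j. j \<in> G \<Longrightarrow> (ini, j) \<in> r"
    using initial_object_exists[OF assms(1)] by auto
  have po: "partial_order_on G r" and fin: "finite G"
    using assms(1) by (auto simp: indexing_category_def)
  interpret initial_index G r ini
    by unfold_locales (use ini fin partial_order_onD[OF po] in auto)
  have "QL G r \<phi> (Prob_h G r) (kappa G r) \<subseteq> QL G r \<phi> (Prob G r) (kappa G r)"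
    by (auto simp: QL_def Prob_h_subset)
  then show ?thesis
    unfolding dense_wrt_def using homogeneous_sequence_close unfolding assms(2) by blast
next
  \<comment> \<open>Without objects there is no initial one, but every diagram is vacuously
    homogeneous and every cost is an empty sum, so each sequence approximates itself.\<close>
  case True
  have "Prob_h G r = Prob G r" by (simp add: True Prob_h_def homogeneous_def)
  moreover have "asymptotic_dist (kappa G r) X X = 0" for X
  proof -
    have "intrinsic_dist G r A B = 0" for A B
    proof -
      have "r = {}" using assms(1) True by (auto simp: indexing_category_def dest: partial_order_onD(4))
      then have "{kd G A Z B | Z f g. two_fan G r A f Z g B} = {0}"
        by (auto simp: True kd_def Ent_dist_def two_fan_def diagram_morphism_def Prob_def)
      then show ?thesis by (simp add: intrinsic_dist_def)
    qed
    then show ?thesis by (simp add: kappa_def asymptotic_dist_def)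
  qed
  ultimately show ?thesis unfolding dense_wrt_def by (metis order_refl)
qed

end
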